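(* Let $G=(V,E)$ be a connected graph on $V=\{1,\dots,p\}$, $p\ge 3$, and let $\mathbf{A}\in\mathbb{R}^{n\times p}$ and $\mathbf{y}=\mathbf{A}\mathbf{x}_*+\mathbf{e}$. Suppose $\mathbf{e}=\mathbf{0}$ and $\mathbf{x}_*\in(\delta\mathbb{Z})^p$, and denote $s_*=\max(\|\nabla\mathbf{x}_*\|_0,1)$. Suppose $\sqrt{\eta}\cdot\mathbf{A}$ satisfies the $(\kappa,\rho)$-cut-restricted isometry property, where $\kappa\in[0,\sqrt{3/2}-1)$. Set $t(\kappa)=1-4\kappa-2\kappa^2\in(0,1]$, and choose tuning parameters $$\left(1-\frac{t(\kappa)}{4}\right)^2<\gamma<1,\qquad \lambda_{\max}>\|\mathbf{x}_*\|_2^2 .$$ For some constants $C,c>0$ depending only on $\kappa$, if $\rho(s_* )\le c$, then each iterate $\mathbf{x}_k$ of the ITALE algorithm (with the $\ell_0$ edge cost) satisfies $$\|\mathbf{x}_k-\mathbf{x}_*\|_2\le C\sqrt{\lambda_{\max}s_*}\cdot\gamma^{k/2}.$$ In particular, $\mathbf{x}_k=\mathbf{x}_*$ for all sufficiently large $k$.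
   Context: Gradient sparsity: for a graph $G=(V,E)$ with $V=\{1,\dots,p\}$ and undirected edge set $E$, $\nabla\mathbf{x}=(x_i-x_j:(i,j)\in E)\in\mathbb{R}^{|E|}$ (with an arbitrary fixed ordering of each edge's endpoints), so $\|\nabla\mathbf{x}\|_0=\#\{(i,j)\in E: x_i\ne x_j\}$. For $\delta>0$, $\delta\mathbb{Z}=\{k\delta:k\in\mathbb{Z}\}$. Cut-restricted isometry property (cRIP): let $\kappa\ge 0$ and let $\rho:[0,\infty)\to[0,\infty)$ be any function satisfying $\rho'(s)\ge 0$ and $\rho''(s)\le 0$ for all $s>0$. A matrix $\mathbf{B}\in\mathbb{R}^{n\times p}$ satisfies $(\kappa,\rho)$-cRIP if for every $\mathbf{x}\in\mathbb{R}^p$ with $\|\nabla\mathbf{x}\|_0\ge 1$, $$\left(1-\kappa-\sqrt{\rho(\|\nabla\mathbf{x}\|_0)}\right)\|\mathbf{x}\|_2\le\|\mathbf{B}\mathbf{x}\|_2\le\left(1+\kappa+\sqrt{\rho(\|\nabla\mathbf{x}\|_0)}\right)\|\mathbf{x}\|_2 .$$ ITALE algorithm: the input is $\mathbf{y}\in\mathbb{R}^n$, $\mathbf{A}\in\mathbb{R}^{n\times p}$ and parameters $\gamma\in(0,1)$, $\lambda_{\max}>\lambda_{\min}>0$, $\eta,\delta>0$. Initialize $\mathbf{x}_0=\mathbf{0}$, $\lambda_0=\lambda_{\max}$. For $k=0,1,2,\dots,K$, until $\lambda_K<\lambda_{\min}$, set $$\mathbf{a}_{k+1}=\mathbf{x}_k-\eta\mathbf{A}^{\mathsf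 T}(\mathbf{A}\mathbf{x}_k-\mathbf{y}),\qquad \mathbf{x}_{k+1}=\mathrm{AlphaExpansion}(\mathbf{a}_{k+1},\lambda_k,\delta),\qquad \lambda_{k+1}=\gamma\lambda_k .$$ The output is $\mathbf{x}_1,\dots,\mathbf{x}_K$. Subroutine $\mathrm{AlphaExpansion}(\mathbf{a},\lambda,\delta)$, with the $\ell_0$ edge cost $c(x,y)=\mathbf{1}\{x\ne y\}$: let $a_{\min},a_{\max}$ be the minimum and maximum entries of $\mathbf{a}$, and initialize $\mathbf{x}$ arbitrarily with coordinates in $\delta\mathbb{Z}$. Repeat the following sweep: for each $z\in\delta\mathbb{Z}\cap[a_{\min},a_{\max}]$, build an edge-weighted augmentation of $G$ as follows. Add a source $s$ and a sink $t$; join $s$ to each $i\in\{1,\dots,p\}$ with weight $\frac12(a_i-z)^2$; join $t$ to each $i$ with weight $\frac12(a_i-x_i)^2$ if $x_i\ne z$ and weight $\infty$ if $x_i=z$. For each edge $\{i,j\}\in E$: if $x_i=x_j$, give it weight $\lambda c(x_i,z)$; otherwise introduce a new vertex $v_{i,j}$ and replace $\{i,j\}$ by the edges $\{i,v_{i,j}\}$, $\{j,v_{i,j}\}$, $\{t,v_{i,j}\}$ with weights $\lambda c(x_i,z)$, $\lambda c(x_j,z)$, $\lambda c(x_i,x_j)$ respectively. Find a minimum $s$-$t$ cut $(S,T)$ with $s\in S$, $t\in T$; update $x_i\leftarrow z$ for each $i\in\{1,\dots,p\}$ with $i\in T$, and leave $x_i$ unchanged if $i\in S$. If a sweep over all $z$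 leaves $\mathbf{x}$ unchanged, return $\mathbf{x}$. The output $\hat{\mathbf{x}}\in(\delta\mathbb{Z})^p$ has the deterministic guarantee $$\frac12\|\hat{\mathbf{x}}-\mathbf{a}\|_2^2+\lambda\|\nabla\hat{\mathbf{x}}\|_0\le\min_{\mathbf{x}\in(\delta\mathbb{Z})^p}\left(\frac12\|\mathbf{x}-\mathbf{a}\|_2^2+2\lambda\|\nabla\mathbf{x}\|_0\right).$$
   Formalization: The isometry inequality is also assumed at x_* with ρ(s_* ) (new only for nonzero constant x_* ), and the stated AlphaExpansion guarantee is assumed for calls where its right-hand minimum is not attained with labels in [a_min,a_max]; without these the claim fails. *)

theory Defs
  imports
    Complex_Main
    "HOL-Library.Extended_Real"
    "Jordan_Normal_Form.Matrix"
begin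

text \<open>
  Vectors and matrices are those of Jordan\_Normal\_Form, so that the dimensions \<open>n\<close>, \<open>p\<close> are
  ordinary natural numbers and constants can be quantified before them.  Indices start at 0:
  the vertex set \<open>{1,...,p}\<close> becomes \<open>{..<p}\<close>.
\<close>

definition l2norm :: "real vec \<Rightarrow> real" where
  "l2norm v = sqrt (v \<bullet> v)"

definition simple_graph :: "nat \<Rightarrow> nat set set \<Rightarrow> bool" where
  "simple_graph p E \<longleftrightarrow> (\<forall>e\<in>E. e \<subseteq> {..<p} \<and> card e = 2)"

definition connected_graph :: "nat \<Rightarrow> nat set set \<Rightarrow> bool" where
  "connected_graph p E \<longleftrightarrow> (\<forall>i<p. \<forall>j<p. (i, j) \<in> {(u, v). {u, v} \<in> E}\<^sup>*)"

definition grad_l0 :: "nat set set \<Rightarrow> real vec \<Rightarrow> nat" where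
  "grad_l0 E x = card {e \<in> E. \<exists>i j. e = {i, j} \<and> x $ i \<noteq> x $ j}"

definition grid :: "real \<Rightarrow> real set" where
  "grid \<delta> = {of_int m * \<delta> | m :: int. True}"

definition grid_vec :: "nat \<Rightarrow> real \<Rightarrow> real vec set" where
  "grid_vec p \<delta> = {x \<in> carrier_vec p. \<forall>i<p. x $ i \<in> grid \<delta>}"


section \<open>Cut-restricted isometry\<close>

text \<open>Only the restriction of \<open>\<rho>\<close> to \<open>[0,\<infinity>)\<close> is relevant.\<close>

definition crip_function :: "(real \<Rightarrow> real) \<Rightarrow> bool" where
  "crip_function \<rho> \<longleftrightarrow> (\<forall>s\<ge>0. \<rho> s \<ge> 0) \<and>
     (\<exists>\<rho>' \<rho>''. \<forall>s>0. (\<rho> has_real_derivative \<rho>' s) (at s) \<and> (\<rho>' has_real_derivative \<rho>'' s) (at s) \<and>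
        \<rho>' s \<ge> 0 \<and> \<rho>'' s \<le> 0)"

definition isometry_bounds :: "real mat \<Rightarrow> real \<Rightarrow> real \<Rightarrow> real vec \<Rightarrow> bool" where
  "isometry_bounds B \<kappa> r x \<longleftrightarrow>
     (1 - \<kappa> - sqrt r) * l2norm x \<le> l2norm (B *\<^sub>v x) \<and>
     l2norm (B *\<^sub>v x) \<le> (1 + \<kappa> + sqrt r) * l2norm x"

definition cRIP :: "nat \<Rightarrow> nat set set \<Rightarrow> real \<Rightarrow> (real \<Rightarrow> real) \<Rightarrow> real mat \<Rightarrow> bool" where
  "cRIP p E \<kappa> \<rho> B \<longleftrightarrow>
     (\<forall>x\<in>carrier_vec p. grad_l0 E x \<ge> 1 \<longrightarrow> isometry_bounds B \<kappa> (\<rho> (real (grad_l0 E x))) x)"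


text \<open>
  cRIP says nothing about constant vectors (a limit argument bounds them only through \<open>\<rho>\<close> at the
  minimum edge cut of the graph).  E.g. for the complete graph, \<open>B = I - J/p\<close> (\<open>J\<close> all ones),
  \<open>\<kappa> = 0\<close> and \<open>\<rho>(s) = c s\<close> with \<open>c (p - 1) \<ge> 1\<close>, cRIP holds although \<open>B\<close> maps all constant
  vectors to 0.  A recovery result for a constant signal therefore needs \<open>isometry_bounds\<close>, with
  \<open>\<rho>(1)\<close>, as a separate hypothesis on that signal.
\<close>


section \<open>Alpha-expansion\<close>

datatype cut_vertex = Source | Sink | Pixel nat | Aux "nat set"

definition l0_cost :: "real \<Rightarrow> real \<Rightarrow> real" where
  "l0_cost u v = (if u \<noteq> v then 1 else 0)"

definition aug_vertices :: "nat \<Rightarrow> nat set set \<Rightarrow> real vec \<Rightarrow> cut_vertex set" where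
  "aug_vertices p E x =
     {Source, Sink} \<union> Pixel ` {..<p} \<union> {Aux {i, j} | i j. {i, j} \<in> E \<and> x $ i \<noteq> x $ j}"

text \<open>
  Weighted undirected edges as triples.  Every undirected edge occurs in exactly one triple (hence
  \<open>i < j\<close> in the third line; the fourth line, over both orders of the endpoints, gives the two
  edges \<open>{i, v\<^sub>i\<^sub>j}\<close> and \<open>{j, v\<^sub>i\<^sub>j}\<close>).
\<close>

definition aug_edges ::
  "nat \<Rightarrow> nat set set \<Rightarrow> real vec \<Rightarrow> real \<Rightarrow> real vec \<Rightarrow> real \<Rightarrow> (cut_vertex \<times> cut_vertex \<times> ereal) set" where
  "aug_edges p E a lam x z =
     {(Source, Pixel i, ereal (1/2 * (a $ i - z)\<^sup>2)) | i. i < p} \<union>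
     {(Sink, Pixel i, if x $ i \<noteq> z then ereal (1/2 * (a $ i - x $ i)\<^sup>2) else \<infinity>) | i. i < p} \<union>
     {(Pixel i, Pixel j, ereal (lam * l0_cost (x $ i) z)) | i j. {i, j} \<in> E \<and> i < j \<and> x $ i = x $ j} \<union>
     {(Pixel i, Aux {i, j}, ereal (lam * l0_cost (x $ i) z)) | i j. {i, j} \<in> E \<and> x $ i \<noteq> x $ j} \<union>
     {(Sink, Aux {i, j}, ereal (lam * l0_cost (x $ i) (x $ j))) | i j. {i, j} \<in> E \<and> x $ i \<noteq> x $ j}"

definition cut_capacity :: "('v \<times> 'v \<times> ereal) set \<Rightarrow> 'v set \<Rightarrow> ereal" where
  "cut_capacity W S = (\<Sum>(u, v, w) \<in> {(u, v, w) \<in> W. (u \<in> S) \<noteq> (v \<in> S)}. w)"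

text \<open>A cut \<open>(S, T)\<close> is given by its source side \<open>S\<close>.\<close>

definition st_cut :: "cut_vertex set \<Rightarrow> cut_vertex set \<Rightarrow> bool" where
  "st_cut V S \<longleftrightarrow> S \<subseteq> V \<and> Source \<in> S \<and> Sink \<notin> S"

definition min_st_cut ::
  "cut_vertex set \<Rightarrow> (cut_vertex \<times> cut_vertex \<times> ereal) set \<Rightarrow> cut_vertex set \<Rightarrow> bool" where
  "min_st_cut V W S \<longleftrightarrow> st_cut V S \<and> (\<forall>S'. st_cut V S' \<longrightarrow> cut_capacity W S \<le> cut_capacity W S')"

text \<open>Minimum cuts need not be unique, so a step is a relation between old and new iterate.\<close>

definition expansion_step ::
  "nat \<Rightarrow> nat set set \<Rightarrow> real vec \<Rightarrow> real \<Rightarrow> real \<Rightarrow> real vec \<Rightarrow> real vec \<Rightarrow> bool" where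
  "expansion_step p E a lam z x x' \<longleftrightarrow>
     (\<exists>S. min_st_cut (aug_vertices p E x) (aug_edges p E a lam x z) S \<and>
          x' = vec p (\<lambda>i. if Pixel i \<in> S then x $ i else z))"

fun expansion_steps ::
  "nat \<Rightarrow> nat set set \<Rightarrow> real vec \<Rightarrow> real \<Rightarrow> real list \<Rightarrow> real vec \<Rightarrow> real vec \<Rightarrow> bool" where
  "expansion_steps p E a lam [] x x' \<longleftrightarrow> x' = x"
| "expansion_steps p E a lam (z # zs) x x' \<longleftrightarrow>
     (\<exists>x''. expansion_step p E a lam z x x'' \<and> expansion_steps p E a lam zs x'' x')"

definition labels :: "nat \<Rightarrow> real vec \<Rightarrow> real \<Rightarrow> real set" where
  "labels p a \<delta> = grid \<delta> \<inter> {Min ((\<lambda>i. a $ i) ` {..<p}) .. Max ((\<lambda>i. a $ i) ` {..<p})}"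

text \<open>The order in which a sweep visits the labels is unspecified, and may vary between sweeps.\<close>

definition sweep ::
  "nat \<Rightarrow> nat set set \<Rightarrow> real vec \<Rightarrow> real \<Rightarrow> real \<Rightarrow> real vec \<Rightarrow> real vec \<Rightarrow> bool" where
  "sweep p E a lam \<delta> x x' \<longleftrightarrow>
     (\<exists>zs. distinct zs \<and> set zs = labels p a \<delta> \<and> expansion_steps p E a lam zs x x')"

text \<open>
  \<open>x\<close> is a possible output: it is reached from an arbitrary initialization by finitely many
  sweeps, and in a final sweep no label changes it.
\<close>

definition alpha_expansion ::
  "nat \<Rightarrow> nat set set \<Rightarrow> real vec \<Rightarrow> real \<Rightarrow> real \<Rightarrow> real vec \<Rightarrow> bool" where
  "alpha_expansion p E a lam \<delta> x \<longleftrightarrow>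
     (\<exists>x\<^sub>0 \<in> grid_vec p \<delta>. (sweep p E a lam \<delta>)\<^sup>*\<^sup>* x\<^sub>0 x) \<and>
     (\<forall>z \<in> labels p a \<delta>. expansion_step p E a lam z x x)"

definition l0_objective :: "nat set set \<Rightarrow> real vec \<Rightarrow> real \<Rightarrow> real vec \<Rightarrow> real" where
  "l0_objective E a lam x = 1/2 * (l2norm (x - a))\<^sup>2 + lam * real (grad_l0 E x)"

definition alpha_guarantee ::
  "nat \<Rightarrow> nat set set \<Rightarrow> real vec \<Rightarrow> real \<Rightarrow> real \<Rightarrow> real vec \<Rightarrow> bool" where
  "alpha_guarantee p E a lam \<delta> x \<longleftrightarrow>
     (\<forall>v \<in> grid_vec p \<delta>. l0_objective E a lam x \<le> l0_objective E a (2 * lam) v)"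

text \<open>
  The subroutine only tries labels in \<open>[a\<^sub>m\<^sub>i\<^sub>n, a\<^sub>m\<^sub>a\<^sub>x]\<close>, whereas the minimum in the guarantee is over
  all of \<open>(\<delta>\<int>)\<^sup>p\<close>.  The guarantee follows from the min-cut construction if that minimum is attained
  with such labels, but it can fail otherwise; e.g. if \<open>[a\<^sub>m\<^sub>i\<^sub>n, a\<^sub>m\<^sub>a\<^sub>x]\<close> contains no point of \<open>\<delta>\<int>\<close>, then
  every initialization is returned unchanged.
\<close>

definition labels_suffice ::
  "nat \<Rightarrow> nat set set \<Rightarrow> real vec \<Rightarrow> real \<Rightarrow> real \<Rightarrow> bool" where
  "labels_suffice p E a lam \<delta> \<longleftrightarrow>
     (\<exists>m \<in> grid_vec p \<delta>. (\<forall>i<p. m $ i \<in> labels p a \<delta>) \<and>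
        (\<forall>v \<in> grid_vec p \<delta>. l0_objective E a (2 * lam) m \<le> l0_objective E a (2 * lam) v))"


section \<open>ITALE\<close>

text \<open>
  \<open>lam\<close>, \<open>a\<close>, \<open>x\<close> record a complete run that stops at the first \<open>K\<close> with \<open>lam K < lam_min\<close>; only
  \<open>lam 0, ..., lam K\<close>, \<open>a 1, ..., a K\<close> and \<open>x 0, ..., x K\<close> are meaningful.
\<close>

definition ITALE_run ::
  "nat \<Rightarrow> nat set set \<Rightarrow> real mat \<Rightarrow> real vec \<Rightarrow> real \<Rightarrow> real \<Rightarrow> real \<Rightarrow> real \<Rightarrow> real \<Rightarrow>
   nat \<Rightarrow> (nat \<Rightarrow> real) \<Rightarrow> (nat \<Rightarrow> real vec) \<Rightarrow> (nat \<Rightarrow> real vec) \<Rightarrow> bool" where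
  "ITALE_run p E A y \<gamma> lam_max lam_min \<eta> \<delta> K lam a x \<longleftrightarrow>
     x 0 = 0\<^sub>v p \<and> lam 0 = lam_max \<and>
     (\<forall>k<K. lam k \<ge> lam_min \<and>
        a (Suc k) = x k - \<eta> \<cdot>\<^sub>v (transpose_mat A *\<^sub>v (A *\<^sub>v x k - y)) \<and>
        alpha_expansion p E (a (Suc k)) (lam k) \<delta> (x (Suc k)) \<and>
        lam (Suc k) = \<gamma> * lam k) \<and>
     lam K < lam_min"

end

theory Submission
  imports Defs
begin

text \<open>
  Write \<open>r\<^sub>k = x k - x\<^sub>s\<close> and \<open>B = sqrt \<eta> \<cdot>\<^sub>m A\<close>. The guarantee of alpha-expansion, compared at \<open>x\<^sub>s\<close>,
  reads \<open>1/2 \<parallel>r\<^sub>k\<^sub>+\<^sub>1\<parallel>\<^sup>2 + \<lambda> \<parallel>\<nabla>x\<^sub>k\<^sub>+\<^sub>1\<parallel>\<^sub>0 \<le> r\<^sub>k\<^sub>+\<^sub>1 \<bullet> r\<^sub>k - B r\<^sub>k\<^sub>+\<^sub>1 \<bullet> B r\<^sub>k + 2 \<lambda> s\<^sub>s\<close>. As long as the iterates have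
  gradient sparsity \<open>O(s\<^sub>s)\<close>, concavity of \<open>\<rho>\<close> and polarization bound the difference of inner products
  by \<open>\<epsilon> \<parallel>r\<^sub>k\<^sub>+\<^sub>1\<parallel> \<parallel>r\<^sub>k\<parallel>\<close> with \<open>2 \<epsilon> \<le> 1 - t/2\<close>. Hence \<open>\<parallel>r\<^sub>k\<^sub>+\<^sub>1\<parallel> \<le> 2 \<epsilon> \<parallel>r\<^sub>k\<parallel> + 2 sqrt (\<lambda> s\<^sub>s)\<close>, and
  \<open>\<parallel>r\<^sub>k\<parallel> \<le> (8/t) sqrt (\<lambda> s\<^sub>s)\<close> improves by the factor \<open>1 - t/4 < sqrt \<gamma>\<close> in each step. Exact recovery
  follows because both \<open>x k\<close> and \<open>x\<^sub>s\<close> lie on the grid.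
\<close>

section \<open>Euclidean norm and near isometries\<close>

lemma l2norm_nonneg [simp]: "l2norm v \<ge> 0"
  unfolding l2norm_def by (simp add: scalar_prod_def sum_nonneg)

lemma l2norm_power2: "(l2norm v)\<^sup>2 = v \<bullet> v"
  unfolding l2norm_def by (simp add: scalar_prod_def sum_nonneg)

lemma l2norm_power2_sum:
  assumes "v \<in> carrier_vec p"
  shows "(l2norm v)\<^sup>2 = (\<Sum>i<p. (v $ i)\<^sup>2)"
  using assms unfolding l2norm_power2
  by (auto simp: scalar_prod_def power2_eq_square atLeast0LessThan)

lemma l2norm_eq_0_iff:
  assumes "v \<in> carrier_vec p"
  shows "l2norm v = 0 \<longleftrightarrow> v = 0\<^sub>v p"
proof
  assume "l2norm v = 0"
  then have "(\<Sum>i<p. (v $ i)\<^sup>2) = 0"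
    using l2norm_power2_sum[OF assms] by simp
  then have "\<forall>i<p. v $ i = 0"
    by (subst (asm) sum_nonneg_eq_0_iff) auto
  then show "v = 0\<^sub>v p" using assms by (intro eq_vecI) auto
next
  assume "v = 0\<^sub>v p"
  then show "l2norm v = 0" by (simp add: l2norm_def)
qed

lemma abs_index_le_l2norm:
  assumes "v \<in> carrier_vec p" "i < p"
  shows "\<bar>v $ i\<bar> \<le> l2norm v"
proof -
  have "(v $ i)\<^sup>2 \<le> (\<Sum>i<p. (v $ i)\<^sup>2)"
    using assms(2) by (intro member_le_sum) auto
  then show ?thesis
    using l2norm_power2_sum[OF assms(1)] by (metis abs_le_square_iff abs_of_nonneg l2norm_nonneg)
qed

lemma l2norm_smult: "l2norm (c \<cdot>\<^sub>v v) = \<bar>c\<bar> * l2norm v"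
proof -
  have "(c \<cdot>\<^sub>v v) \<bullet> (c \<cdot>\<^sub>v v) = c\<^sup>2 * (v \<bullet> v)"
    by (simp add: power2_eq_square)
  then show ?thesis by (simp add: l2norm_def real_sqrt_mult)
qed

lemma scalar_prod_lincomb:
  fixes u v :: "real vec"
  assumes "u \<in> carrier_vec n" "v \<in> carrier_vec n"
  shows "(a \<cdot>\<^sub>v u + b \<cdot>\<^sub>v v) \<bullet> (a \<cdot>\<^sub>v u + b \<cdot>\<^sub>v v)
    = a\<^sup>2 * (u \<bullet> u) + 2 * a * b * (u \<bullet> v) + b\<^sup>2 * (v \<bullet> v)"
proof -
  have "v \<bullet> u = u \<bullet> v" using assms by (intro comm_scalar_prod)
  then show ?thesis
    using assms by (simp add: add_scalar_prod_distrib[of _ n] scalar_prod_add_distrib[of _ n]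
      power2_eq_square algebra_simps)
qed

lemma mult_mat_vec_lincomb:
  fixes B :: "real mat"
  assumes "B \<in> carrier_mat n p" "u \<in> carrier_vec p" "v \<in> carrier_vec p"
  shows "B *\<^sub>v (a \<cdot>\<^sub>v u + b \<cdot>\<^sub>v v) = a \<cdot>\<^sub>v (B *\<^sub>v u) + b \<cdot>\<^sub>v (B *\<^sub>v v)"
  using assms by (simp add: mult_add_distrib_mat_vec[of _ n p] mult_mat_vec[of _ n p])

text \<open>Both signs of the inner product come from the nonnegative square of
  \<open>?b u + b ?a v\<close>, where \<open>b\<close> is 1 or -1.\<close>

lemma l2norm_Cauchy_Schwarz:
  assumes u: "u \<in> carrier_vec n" and v: "v \<in> carrier_vec n"
  shows "\<bar>u \<bullet> v\<bar> \<le> l2norm u * l2norm v"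
proof (cases "l2norm u = 0 \<or> l2norm v = 0")
  case True
  then show ?thesis using l2norm_eq_0_iff[OF u] l2norm_eq_0_iff[OF v] u v by auto
next
  case False
  let ?a = "l2norm u" and ?b = "l2norm v"
  have pos: "?a * ?b > 0" using False by (simp add: less_le)
  have "2 * b * (?a * ?b) * (u \<bullet> v) \<ge> - (2 * (?a * ?b)\<^sup>2)" if "b\<^sup>2 = 1" for b
  proof -
    have "0 \<le> (l2norm (?b \<cdot>\<^sub>v u + (b * ?a) \<cdot>\<^sub>v v))\<^sup>2" by simp
    also have "\<dots> = ?b\<^sup>2 * ?a\<^sup>2 + 2 * ?b * (b * ?a) * (u \<bullet> v) + b\<^sup>2 * ?a\<^sup>2 * ?b\<^sup>2"
      by (simp only: l2norm_power2 scalar_prod_lincomb[OF u v] power_mult_distrib)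
    finally show ?thesis using that by (simp add: power_mult_distrib algebra_simps)
  qed
  from this[of 1] this[of "-1"]
  have "(?a * ?b) * \<bar>u \<bullet> v\<bar> \<le> (?a * ?b) * (?a * ?b)"
    by (cases "u \<bullet> v \<ge> 0") (simp_all add: power2_eq_square algebra_simps)
  with pos show ?thesis by (simp only: mult_le_cancel_left_pos)
qed

text \<open>Polarization, with the two vectors scaled to equal length.\<close>

lemma near_isometry_scalar_prod:
  fixes B :: "real mat"
  assumes B: "B \<in> carrier_mat n p" and u: "u \<in> carrier_vec p" and v: "v \<in> carrier_vec p"
    and near: "\<And>a b. \<bar>(l2norm (a \<cdot>\<^sub>v u + b \<cdot>\<^sub>v v))\<^sup>2 - (l2norm (B *\<^sub>v (a \<cdot>\<^sub>v u + b \<cdot>\<^sub>v v)))\<^sup>2\<bar>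
      \<le> \<epsilon> * (l2norm (a \<cdot>\<^sub>v u + b \<cdot>\<^sub>v v))\<^sup>2"
  shows "u \<bullet> v - (B *\<^sub>v u) \<bullet> (B *\<^sub>v v) \<le> \<epsilon> * (l2norm u * l2norm v)"
proof (cases "l2norm u = 0 \<or> l2norm v = 0")
  case True
  have "B *\<^sub>v 0\<^sub>v p = 0\<^sub>v n" using B by (intro eq_vecI) auto
  then show ?thesis using True l2norm_eq_0_iff[OF u] l2norm_eq_0_iff[OF v] u v B by auto
next
  case False
  let ?a = "l2norm u" and ?b = "l2norm v" and ?q = "u \<bullet> v - (B *\<^sub>v u) \<bullet> (B *\<^sub>v v)"
  have pos: "?a * ?b > 0" using False by (simp add: less_le)
  have Bu: "B *\<^sub>v u \<in> carrier_vec n" and Bv: "B *\<^sub>v v \<in> carrier_vec n" using B u v by auto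
  note sq = l2norm_power2 mult_mat_vec_lincomb[OF B u v] scalar_prod_lincomb[OF u v]
    scalar_prod_lincomb[OF Bu Bv]
  \<comment> \<open>\<open>f\<close> and \<open>g\<close> collect the square terms of
    \<open>?b u + ?a v\<close> and of its image under \<open>B\<close>; the vector with
    \<open>- ?a\<close> has the same ones. Adding the two estimates cancels \<open>f\<close> and
    \<open>g\<close> on the left and the inner products on the right.\<close>
  define f g where "f = 2 * ((u \<bullet> u) * (v \<bullet> v))"
    and "g = (v \<bullet> v) * ((B *\<^sub>v u) \<bullet> (B *\<^sub>v u)) + (u \<bullet> u) * ((B *\<^sub>v v) \<bullet> (B *\<^sub>v v))"
  have "f + 2 * (?a * ?b) * (u \<bullet> v) - (g + 2 * (?a * ?b) * ((B *\<^sub>v u) \<bullet> (B *\<^sub>v v)))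
      \<le> \<epsilon> * (f + 2 * (?a * ?b) * (u \<bullet> v))"
    using near[of ?b ?a, THEN abs_le_D1] unfolding sq f_def g_def by (simp add: algebra_simps)
  moreover have "(g - 2 * (?a * ?b) * ((B *\<^sub>v u) \<bullet> (B *\<^sub>v v))) - (f - 2 * (?a * ?b) * (u \<bullet> v))
      \<le> \<epsilon> * (f - 2 * (?a * ?b) * (u \<bullet> v))"
    using near[of ?b "- ?a", THEN abs_le_D2] unfolding sq f_def g_def
    by (simp add: algebra_simps l2norm_power2)
  ultimately have "4 * (?a * ?b) * ?q \<le> \<epsilon> * (4 * ((u \<bullet> u) * ?b\<^sup>2))"
    by (simp add: f_def l2norm_power2 algebra_simps)
  also have "u \<bullet> u = ?a\<^sup>2" by (simp add: l2norm_power2)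
  finally have "(?a * ?b) * ?q \<le> (?a * ?b) * (\<epsilon> * (?a * ?b))"
    by (simp add: power2_eq_square algebra_simps)
  with pos show ?thesis by (simp only: mult_le_cancel_left_pos)
qed

text \<open>With \<tau> = \<kappa> + sqrt r, squaring the factors 1 - \<tau> and 1 + \<tau> leaves a
  defect of at most 2 \<tau> + \<tau>^2.\<close>

lemma isometry_bounds_power2:
  assumes iso: "isometry_bounds B \<kappa> r x" and "0 \<le> \<kappa>" "0 \<le> r"
    and \<epsilon>: "2 * (\<kappa> + sqrt r) + (\<kappa> + sqrt r)\<^sup>2 \<le> \<epsilon>"
  shows "\<bar>(l2norm x)\<^sup>2 - (l2norm (B *\<^sub>v x))\<^sup>2\<bar> \<le> \<epsilon> * (l2norm x)\<^sup>2"
proof -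
  define \<tau> X Y where "\<tau> = \<kappa> + sqrt r" and "X = l2norm x" and "Y = l2norm (B *\<^sub>v x)"
  have \<tau>: "\<tau> \<ge> 0" using assms by (simp add: \<tau>_def)
  have XY: "X \<ge> 0" "Y \<ge> 0" by (simp_all add: X_def Y_def)
  have lo: "(1 - \<tau>) * X \<le> Y" and up: "Y \<le> (1 + \<tau>) * X"
    using iso by (simp_all add: isometry_bounds_def \<tau>_def X_def Y_def algebra_simps)
  have e: "(2 * \<tau> + \<tau>\<^sup>2) * X\<^sup>2 \<le> \<epsilon> * X\<^sup>2"
    using \<epsilon> by (intro mult_right_mono) (auto simp: \<tau>_def)
  have "Y\<^sup>2 \<le> ((1 + \<tau>) * X)\<^sup>2" using up XY by (intro power_mono)
  then have 1: "Y\<^sup>2 - X\<^sup>2 \<le> \<epsilon> * X\<^sup>2" using e by (simp add: power2_eq_square algebra_simps)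
  have 2: "X\<^sup>2 - Y\<^sup>2 \<le> \<epsilon> * X\<^sup>2"
  proof (cases "\<tau> \<le> 1")
    case True
    then have "((1 - \<tau>) * X)\<^sup>2 \<le> Y\<^sup>2" using lo XY by (intro power_mono) auto
    moreover have "0 \<le> \<tau>\<^sup>2 * X\<^sup>2" by simp
    ultimately show ?thesis using e by (simp add: power2_eq_square algebra_simps)
  next
    \<comment> \<open>For \<tau> > 1 the lower isometry bound has a negative factor and cannot be
      squared, but then the allowed defect already exceeds \<open>X\<^sup>2\<close>.\<close>
    case False
    then have "1 * X\<^sup>2 \<le> (2 * \<tau> + \<tau>\<^sup>2) * X\<^sup>2" by (intro mult_right_mono) (auto intro: add_increasing2)
    moreover have "Y\<^sup>2 \<ge> 0" by simp
    ultimately show ?thesis using e by linarith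
  qed
  from 1 2 show ?thesis by (simp add: X_def Y_def abs_le_iff)
qed

section \<open>Growth of \<rho>\<close>

lemma crip_function_mono:
  assumes "crip_function \<rho>" "0 < s" "s \<le> m"
  shows "\<rho> s \<le> \<rho> m"
proof -
  from assms(1) obtain \<rho>' \<rho>'' where d: "\<And>s. s > 0 \<Longrightarrow> (\<rho> has_real_derivative \<rho>' s) (at s) \<and> \<rho>' s \<ge> 0"
    unfolding crip_function_def by blast
  show ?thesis
    by (rule DERIV_nonneg_imp_nondecreasing[OF assms(3)]) (meson d assms(2) less_le_trans)
qed

text \<open>Concavity and nonnegativity make \<rho>(s)/s nonincreasing: a sparsity larger by a
  constant factor costs at most that factor in \<rho>. The core is s \<rho>'(s) \<le> \<rho>(s), the
  tangent at s being nonnegative at the origin.\<close>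

lemma crip_function_le_linear:
  assumes "crip_function \<rho>" and s: "0 < s" "s \<le> m"
  shows "\<rho> m \<le> m / s * \<rho> s"
proof -
  from assms(1) obtain \<rho>' \<rho>'' where d:
      "\<And>s. s > 0 \<Longrightarrow> (\<rho> has_real_derivative \<rho>' s) (at s)"
      "\<And>s. s > 0 \<Longrightarrow> (\<rho>' has_real_derivative \<rho>'' s) (at s)"
      "\<And>s. s > 0 \<Longrightarrow> \<rho>'' s \<le> 0" "\<And>s. s \<ge> 0 \<Longrightarrow> \<rho> s \<ge> 0"
    unfolding crip_function_def by blast
  have anti: "\<rho>' v \<le> \<rho>' u" if "0 < u" "u \<le> v" for u v
    by (rule DERIV_nonpos_imp_nonincreasing[OF that(2)]) (meson d that(1) less_le_trans)
  have secant: "(v - u) * \<rho>' v \<le> \<rho> v - \<rho> u \<and> \<rho> v - \<rho> u \<le> (v - u) * \<rho>' u" if "0 < u" "u < v" for u v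
  proof -
    have "\<exists>z>u. z < v \<and> \<rho> v - \<rho> u = (v - u) * \<rho>' z"
      using that by (intro MVT2 d(1)) auto
    then obtain z where z: "u < z" "z < v" "\<rho> v - \<rho> u = (v - u) * \<rho>' z" by blast
    then show ?thesis using anti[of u z] anti[of z v] that by (auto intro!: mult_left_mono)
  qed
  have "s * \<rho>' s \<le> \<rho> s"
  proof (rule ccontr)
    assume n: "\<not> ?thesis"
    then have pos: "\<rho>' s > 0" using d(4)[of s] s by (smt (verit) mult_nonneg_nonpos)
    define u where "u = (s - \<rho> s / \<rho>' s) / 2"
    have "\<rho> s / \<rho>' s < s" "0 \<le> \<rho> s / \<rho>' s"
      using n pos d(4)[of s] s by (simp_all add: field_simps)
    then have u: "0 < u" "u < s" by (auto simp: u_def)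
    have "(s - u) * \<rho>' s \<le> \<rho> s" using secant[OF u] d(4)[of u] u by simp
    moreover have "(s - u) * \<rho>' s = (s * \<rho>' s + \<rho> s) / 2"
      using pos by (simp add: u_def field_simps)
    ultimately show False using n by (simp add: algebra_simps)
  qed
  then have "(m - s) * \<rho>' s \<le> (m - s) * (\<rho> s / s)"
    using s by (intro mult_left_mono) (auto simp: field_simps)
  moreover have "\<rho> m - \<rho> s \<le> (m - s) * \<rho>' s" using secant[of s m] s by (cases "s = m") auto
  ultimately have "\<rho> m \<le> \<rho> s + (m - s) * (\<rho> s / s)" by linarith
  also have "\<dots> = m / s * \<rho> s" using s by (simp add: field_simps)
  finally show ?thesis .
qed

section \<open>Alpha-expansion\<close>

definition edge_cut :: "real vec \<Rightarrow> nat set \<Rightarrow> real" where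
  "edge_cut x e = of_bool (\<exists>i j. e = {i, j} \<and> x $ i \<noteq> x $ j)"

lemma edge_cut_pair: "edge_cut x {i, j} = of_bool (x $ i \<noteq> x $ j)"
  unfolding edge_cut_def by (auto simp: doubleton_eq_iff)

lemma simple_graph_finite: "simple_graph p E \<Longrightarrow> finite E"
  unfolding simple_graph_def by (rule finite_subset[of _ "Pow {..<p}"]) auto

lemma simple_graph_edgeE:
  assumes "simple_graph p E" "e \<in> E"
  obtains i j where "e = {i, j}" "i < j" "j < p"
proof -
  have "e \<subseteq> {..<p}" "card e = 2" using assms by (auto simp: simple_graph_def)
  then obtain u v where uv: "e = {u, v}" "u \<noteq> v" "u < p" "v < p"
    by (auto simp: card_2_iff)
  show ?thesis
    using that[of u v] that[of v u] uv by (cases "u < v") (auto simp: insert_commute)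
qed

lemma grad_l0_eq_sum: "finite E \<Longrightarrow> real (grad_l0 E x) = (\<Sum>e\<in>E. edge_cut x e)"
  unfolding grad_l0_def edge_cut_def of_bool_def by (subst sum.inter_filter[symmetric]) auto

lemma l0_objective_eq_sum:
  assumes "finite E" "x \<in> carrier_vec p" "a \<in> carrier_vec p"
  shows "l0_objective E a lam x = (\<Sum>i<p. 1/2 * (a $ i - x $ i)\<^sup>2) + lam * (\<Sum>e\<in>E. edge_cut x e)"
proof -
  have "(l2norm (x - a))\<^sup>2 = (\<Sum>i<p. (a $ i - x $ i)\<^sup>2)"
    using assms by (subst l2norm_power2_sum[of _ p]) (auto simp: power2_commute intro!: sum.cong)
  then show ?thesis
    using assms(1) by (simp add: l0_objective_def grad_l0_eq_sum sum_divide_distrib)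
qed

section \<open>Cut capacities in the augmented graph\<close>

definition pixel_arcs :: "real vec \<Rightarrow> real vec \<Rightarrow> real \<Rightarrow> nat \<Rightarrow> (cut_vertex \<times> cut_vertex \<times> ereal) set" where
  "pixel_arcs a x z i =
    {(Source, Pixel i, ereal (1/2 * (a $ i - z)\<^sup>2)),
     (Sink, Pixel i, if x $ i \<noteq> z then ereal (1/2 * (a $ i - x $ i)\<^sup>2) else \<infinity>)}"

definition edge_arcs :: "real \<Rightarrow> real vec \<Rightarrow> real \<Rightarrow> nat set \<Rightarrow> (cut_vertex \<times> cut_vertex \<times> ereal) set" where
  "edge_arcs lam x z e =
    {(Pixel i, Pixel j, ereal (lam * l0_cost (x $ i) z)) | i j. e = {i, j} \<and> i < j \<and> x $ i = x $ j} \<union>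
    {(Pixel i, Aux e, ereal (lam * l0_cost (x $ i) z)) | i j. e = {i, j} \<and> x $ i \<noteq> x $ j} \<union>
    {(Sink, Aux e, ereal (lam * l0_cost (x $ i) (x $ j))) | i j. e = {i, j} \<and> x $ i \<noteq> x $ j}"

lemma aug_edges_eq:
  "aug_edges p E a lam x z = (\<Union>i<p. pixel_arcs a x z i) \<union> (\<Union>e\<in>E. edge_arcs lam x z e)"
proof -
  have "(\<Union>i<p. pixel_arcs a x z i) =
      {(Source, Pixel i, ereal (1/2 * (a $ i - z)\<^sup>2)) | i. i < p} \<union>
      {(Sink, Pixel i, if x $ i \<noteq> z then ereal (1/2 * (a $ i - x $ i)\<^sup>2) else \<infinity>) | i. i < p}"
    unfolding pixel_arcs_def by blast
  moreover have "(\<Union>e\<in>E. edge_arcs lam x z e) =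
      {(Pixel i, Pixel j, ereal (lam * l0_cost (x $ i) z)) | i j. {i, j} \<in> E \<and> i < j \<and> x $ i = x $ j} \<union>
      {(Pixel i, Aux {i, j}, ereal (lam * l0_cost (x $ i) z)) | i j. {i, j} \<in> E \<and> x $ i \<noteq> x $ j} \<union>
      {(Sink, Aux {i, j}, ereal (lam * l0_cost (x $ i) (x $ j))) | i j. {i, j} \<in> E \<and> x $ i \<noteq> x $ j}"
    unfolding edge_arcs_def UN_Un_distrib by (intro arg_cong2[of _ _ _ _ "(\<union>)"]; blast)
  ultimately show ?thesis unfolding aug_edges_def by (simp only: Un_assoc)
qed

lemma Collect_doubleton_less:
  assumes "i < (j :: nat)"
  shows "{f a b | a b. {i, j} = {a, b} \<and> a < b \<and> P a b} = (if P i j then {f i j} else {})"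
  using assms by (auto simp: doubleton_eq_iff)

lemma Collect_doubleton:
  "{f a b | a b. {i, j} = {a, b} \<and> P a b} =
    (if P i j then {f i j} else {}) \<union> (if P j i then {f j i} else {})"
  by (auto simp: doubleton_eq_iff)

text \<open>The two orders of the endpoints give the same sink arc, since both costs are 1; as an
  element of a set it contributes its weight \<open>lam\<close> only once.\<close>

lemma edge_arcs_pair:
  assumes "i < j"
  shows "edge_arcs lam x z {i, j} =
    (if x $ i = x $ j then {(Pixel i, Pixel j, ereal (lam * l0_cost (x $ i) z))}
     else {(Pixel i, Aux {i, j}, ereal (lam * l0_cost (x $ i) z)),
           (Pixel j, Aux {i, j}, ereal (lam * l0_cost (x $ j) z)),
           (Sink, Aux {i, j}, ereal lam)})"
proof -
  have "l0_cost (x $ i) (x $ j) = 1" "l0_cost (x $ j) (x $ i) = 1" if "x $ i \<noteq> x $ j"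
    using that by (simp_all add: l0_cost_def)
  then show ?thesis
    unfolding edge_arcs_def Collect_doubleton_less[OF assms] Collect_doubleton
    by (cases "x $ i = x $ j") (simp_all add: insert_commute)
qed

text \<open>Weight 0 for uncut arcs makes the index set of the capacity sum independent of
  \<open>S\<close>.\<close>

definition arc_cut :: "'v set \<Rightarrow> 'v \<times> 'v \<times> ereal \<Rightarrow> ereal" where
  "arc_cut S = (\<lambda>(u, v, w). if (u \<in> S) \<noteq> (v \<in> S) then w else 0)"

lemma cut_capacity_eq_sum:
  assumes "finite W"
  shows "cut_capacity W S = (\<Sum>t\<in>W. arc_cut S t)"
proof -
  have "{(u, v, w) \<in> W. (u \<in> S) \<noteq> (v \<in> S)} = {t \<in> W. (fst t \<in> S) \<noteq> (fst (snd t) \<in> S)}"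
    by auto
  then show ?thesis
    unfolding cut_capacity_def using assms
    by (simp only:) (subst sum.inter_filter, auto simp: arc_cut_def split_beta intro!: sum.cong)
qed

text \<open>The arc groups are disjoint, because each arc reveals its pixel or its edge through its
  endpoints. Capacity and objective can therefore be compared pixel by pixel and edge by
  edge.\<close>

lemma cut_capacity_aug_edges:
  assumes G: "simple_graph p E"
  shows "cut_capacity (aug_edges p E a lam x z) S =
    (\<Sum>i<p. \<Sum>t\<in>pixel_arcs a x z i. arc_cut S t) + (\<Sum>e\<in>E. \<Sum>t\<in>edge_arcs lam x z e. arc_cut S t)"
proof -
  have fin: "finite (pixel_arcs a x z i)" for i by (simp add: pixel_arcs_def)
  have fin': "finite (edge_arcs lam x z e)" if "e \<in> E" for e
    using simple_graph_edgeE[OF G that] by (metis edge_arcs_pair finite.emptyI finite.insertI)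
  have "(\<Union>i<p. pixel_arcs a x z i) \<inter> (\<Union>e\<in>E. edge_arcs lam x z e) = {}"
    by (auto simp: pixel_arcs_def edge_arcs_def)
  moreover have "pixel_arcs a x z i \<inter> pixel_arcs a x z j = {}" if "i \<noteq> j" for i j
    using that by (auto simp: pixel_arcs_def)
  moreover have "edge_arcs lam x z e \<inter> edge_arcs lam x z f = {}" if "e \<noteq> f" for e f
    using that by (auto simp: edge_arcs_def)
  ultimately show ?thesis
    using fin fin' simple_graph_finite[OF G]
    by (simp add: aug_edges_eq cut_capacity_eq_sum sum.union_disjoint sum.UNION_disjoint)
qed

text \<open>At a pixel the cut pays the data term of the new label, or infinity. At an edge with two
  different labels, at most one of them is \<open>z\<close>, so wherever the auxiliary vertex lies,
  the cut pays at least \<open>lam\<close> if the endpoints end up different.\<close>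

lemma objective_le_cut_capacity:
  assumes G: "simple_graph p E" and lam: "lam \<ge> 0" and a: "a \<in> carrier_vec p"
    and S: "Source \<in> S" "Sink \<notin> S"
    and x': "x' = vec p (\<lambda>i. if Pixel i \<in> S then x $ i else z)"
  shows "ereal (l0_objective E a lam x') \<le> cut_capacity (aug_edges p E a lam x z) S"
proof -
  have "ereal (1/2 * (a $ i - x' $ i)\<^sup>2) \<le> (\<Sum>t\<in>pixel_arcs a x z i. arc_cut S t)" if "i < p" for i
    using that S by (simp add: x' pixel_arcs_def arc_cut_def zero_ereal_def)
  then have 1: "(\<Sum>i<p. ereal (1/2 * (a $ i - x' $ i)\<^sup>2)) \<le> (\<Sum>i<p. \<Sum>t\<in>pixel_arcs a x z i. arc_cut S t)"
    by (intro sum_mono) auto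
  have "ereal (lam * edge_cut x' e) \<le> (\<Sum>t\<in>edge_arcs lam x z e. arc_cut S t)" if "e \<in> E" for e
  proof -
    from simple_graph_edgeE[OF G that] obtain i j where ij: "e = {i, j}" "i < j" "j < p" .
    have ij': "i < p" "i \<noteq> j" using ij by auto
    show ?thesis
      using ij ij' S lam
      by (cases "x $ i = x $ j"; cases "Pixel i \<in> S"; cases "Pixel j \<in> S"; cases "Aux e \<in> S")
        (simp_all add: edge_arcs_pair edge_cut_pair x' arc_cut_def l0_cost_def zero_ereal_def)
  qed
  then have 2: "(\<Sum>e\<in>E. ereal (lam * edge_cut x' e)) \<le> (\<Sum>e\<in>E. \<Sum>t\<in>edge_arcs lam x z e. arc_cut S t)"
    by (intro sum_mono) auto
  have "x' \<in> carrier_vec p" by (simp add: x')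
  then show ?thesis
    using add_mono[OF 1 2] G a
    by (simp add: l0_objective_eq_sum[OF simple_graph_finite] cut_capacity_aug_edges sum_distrib_left)
qed

text \<open>An auxiliary vertex is placed on the source side exactly when both of its pixels keep
  their labels. With this placement every local estimate is an equality. Pixels in \<open>K\<close>
  have labels other than \<open>z\<close>, so no infinite arc is cut.\<close>

lemma cut_capacity_le_objective:
  assumes G: "simple_graph p E" and a: "a \<in> carrier_vec p"
    and K: "K \<subseteq> {..<p}" "\<And>i. i \<in> K \<Longrightarrow> x $ i \<noteq> z"
    and x': "x' = vec p (\<lambda>i. if i \<in> K then x $ i else z)"
  obtains S where "st_cut (aug_vertices p E x) S"
    "cut_capacity (aug_edges p E a lam x z) S \<le> ereal (l0_objective E a lam x')"
proof -
  define S where "S = {Source} \<union> Pixel ` K \<union> Aux ` {e \<in> E. e \<subseteq> K \<and> (\<exists>i j. e = {i, j} \<and> x $ i \<noteq> x $ j)}"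
  have S: "Source \<in> S" "Sink \<notin> S" "Pixel i \<in> S \<longleftrightarrow> i \<in> K" for i by (auto simp: S_def)
  have st: "st_cut (aug_vertices p E x) S"
    using K(1) unfolding st_cut_def aug_vertices_def S_def by auto
  have "(\<Sum>t\<in>pixel_arcs a x z i. arc_cut S t) = ereal (1/2 * (a $ i - x' $ i)\<^sup>2)" if "i < p" for i
    using that S K(2)[of i] by (simp add: x' pixel_arcs_def arc_cut_def zero_ereal_def)
  moreover have "(\<Sum>t\<in>edge_arcs lam x z e. arc_cut S t) = ereal (lam * edge_cut x' e)" if "e \<in> E" for e
  proof -
    from simple_graph_edgeE[OF G that] obtain i j where ij: "e = {i, j}" "i < j" "j < p" .
    have ij': "i < p" "i \<noteq> j" using ij by auto
    have aux: "Aux {i, j} \<in> S \<longleftrightarrow> i \<in> K \<and> j \<in> K" if "x $ i \<noteq> x $ j"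
      using that \<open>e \<in> E\<close> ij by (auto simp: S_def)
    show ?thesis
      using ij ij' S K(2)[of i] K(2)[of j] aux
      by (cases "x $ i = x $ j"; cases "i \<in> K"; cases "j \<in> K")
        (simp_all add: edge_arcs_pair edge_cut_pair x' arc_cut_def l0_cost_def zero_ereal_def)
  qed
  moreover have "x' \<in> carrier_vec p" by (simp add: x')
  ultimately have "cut_capacity (aug_edges p E a lam x z) S = ereal (l0_objective E a lam x')"
    using a G by (simp add: l0_objective_eq_sum[OF simple_graph_finite] cut_capacity_aug_edges sum_distrib_left)
  with st that show ?thesis by simp
qed

text \<open>The minimum cut bounds the objective of its own move from above and is at most the
  capacity of the cut built for any competing move.\<close>

lemma expansion_step_optimal:
  assumes G: "simple_graph p E" and lam: "lam \<ge> 0" and a: "a \<in> carrier_vec p"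
    and step: "expansion_step p E a lam z x x'" 
  shows "l0_objective E a lam x' \<le> l0_objective E a lam (vec p (\<lambda>i. if i \<in> K then x $ i else z))"
proof -
  from step obtain S where S: "min_st_cut (aug_vertices p E x) (aug_edges p E a lam x z) S"
    and x': "x' = vec p (\<lambda>i. if Pixel i \<in> S then x $ i else z)"
    unfolding expansion_step_def by blast
  \<comment> \<open>Dropping pixels that already carry \<open>z\<close> does not change the move and
    keeps infinite arcs uncut.\<close>
  define K' where "K' = {i \<in> K. i < p \<and> x $ i \<noteq> z}"
  have eq: "vec p (\<lambda>i. if i \<in> K then x $ i else z) = vec p (\<lambda>i. if i \<in> K' then x $ i else z)"
    by (rule eq_vecI) (auto simp: K'_def)
  obtain S' where S': "st_cut (aug_vertices p E x) S'"
    "cut_capacity (aug_edges p E a lam x z) S'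
      \<le> ereal (l0_objective E a lam (vec p (\<lambda>i. if i \<in> K' then x $ i else z)))"
    by (rule cut_capacity_le_objective[OF G a _ _ refl, of K' x z]) (auto simp: K'_def)
  have "ereal (l0_objective E a lam x') \<le> cut_capacity (aug_edges p E a lam x z) S"
    using S by (intro objective_le_cut_capacity[OF G lam a _ _ x']) (auto simp: min_st_cut_def st_cut_def)
  also have "\<dots> \<le> cut_capacity (aug_edges p E a lam x z) S'"
    using S S'(1) by (auto simp: min_st_cut_def)
  also note S'(2)
  finally show ?thesis by (simp add: eq)
qed

text \<open>
  Comparing with the moves that give label \<open>z\<close> to all of \<open>{i. m $ i = z}\<close> and summing over \<open>z\<close>, every
  edge cut by \<open>m\<close> is paid for twice, once from each endpoint.
\<close>

lemma expansion_fixpoint_le: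
  assumes G: "simple_graph p E" and lam: "lam \<ge> 0"
    and x: "x \<in> carrier_vec p" and a: "a \<in> carrier_vec p" and m: "m \<in> carrier_vec p"
    and step: "\<And>i. i < p \<Longrightarrow> expansion_step p E a lam (m $ i) x x"
  shows "l0_objective E a lam x \<le> l0_objective E a (2 * lam) m"
proof -
  define Z where "Z = (\<lambda>i. m $ i) ` {..<p}"
  define X where "X z = vec p (\<lambda>i. if m $ i \<noteq> z then x $ i else z)" for z
  define d where "d v i = 1/2 * (a $ i - v $ i)\<^sup>2" for v i
  have fin: "finite E" "finite Z" using simple_graph_finite[OF G] by (auto simp: Z_def)
  have X: "X z \<in> carrier_vec p" for z by (simp add: X_def)
  have Xi: "X z $ i = (if m $ i \<noteq> z then x $ i else z)" if "i < p" for z i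
    using that by (simp add: X_def)
  note obj = l0_objective_eq_sum[OF fin(1) _ a, folded d_def]
  have le: "0 \<le> (\<Sum>i<p. d (X z) i - d x i) + lam * (\<Sum>e\<in>E. edge_cut (X z) e - edge_cut x e)"
    if "z \<in> Z" for z
  proof -
    have "expansion_step p E a lam z x x" using that step by (auto simp: Z_def)
    from expansion_step_optimal[OF G lam a this, of "{i. m $ i \<noteq> z}"]
    have "l0_objective E a lam x \<le> l0_objective E a lam (X z)" by (simp add: X_def)
    then show ?thesis by (simp add: obj[OF x] obj[OF X] sum_subtractf right_diff_distrib)
  qed
  have "0 \<le> (\<Sum>z\<in>Z. (\<Sum>i<p. d (X z) i - d x i) + lam * (\<Sum>e\<in>E. edge_cut (X z) e - edge_cut x e))"
    by (intro sum_nonneg le)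
  also have "\<dots> = (\<Sum>i<p. \<Sum>z\<in>Z. d (X z) i - d x i) + lam * (\<Sum>e\<in>E. \<Sum>z\<in>Z. edge_cut (X z) e - edge_cut x e)"
    by (simp only: sum.distrib sum_distrib_left sum.swap[of _ _ Z])
  also have "(\<Sum>i<p. \<Sum>z\<in>Z. d (X z) i - d x i) = (\<Sum>i<p. d m i - d x i)"
  proof (rule sum.cong[OF refl])
    fix i assume i: "i \<in> {..<p}"
    \<comment> \<open>Pixel \<open>i\<close> is relabelled only by the move with
      \<open>z = m $ i\<close>.\<close>
    have "(\<Sum>z\<in>Z. d (X z) i - d x i) = (\<Sum>z\<in>Z. if z = m $ i then d m i - d x i else 0)"
      using i by (intro sum.cong) (auto simp: d_def Xi)
    then show "(\<Sum>z\<in>Z. d (X z) i - d x i) = d m i - d x i"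
      using i fin by (auto simp: Z_def)
  qed
  also have "(\<Sum>e\<in>E. \<Sum>z\<in>Z. edge_cut (X z) e - edge_cut x e) \<le> (\<Sum>e\<in>E. 2 * edge_cut m e - edge_cut x e)"
  proof (rule sum_mono)
    fix e assume "e \<in> E"
    from simple_graph_edgeE[OF G this] obtain i j where ij: "e = {i, j}" "i < j" "j < p" .
    have ijp: "i < p" using ij by auto
    have Z: "m $ i \<in> Z" "m $ j \<in> Z" using ij ijp by (auto simp: Z_def)
    \<comment> \<open>The other moves leave both endpoints as they are.\<close>
    have "(\<Sum>z\<in>Z. edge_cut (X z) e - edge_cut x e) = (\<Sum>z\<in>{m $ i, m $ j}. edge_cut (X z) e - edge_cut x e)"
      using Z fin ij ijp by (intro sum.mono_neutral_right) (auto simp: edge_cut_pair Xi)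
    \<comment> \<open>Equal labels under \<open>m\<close>: one move makes the endpoints agree and
      saves \<open>edge_cut x e\<close>. Different labels: each of the two moves costs at most 1,
      and one of the two savings is given away.\<close>
    also have "\<dots> \<le> 2 * edge_cut m e - edge_cut x e"
      using ij ijp by (cases "m $ i = m $ j") (auto simp: edge_cut_pair Xi)
    finally show "(\<Sum>z\<in>Z. edge_cut (X z) e - edge_cut x e) \<le> 2 * edge_cut m e - edge_cut x e" .
  qed
  finally show ?thesis
    using lam by (simp add: obj[OF x] obj[OF m] sum_subtractf right_diff_distrib mult_left_mono
      flip: sum_distrib_left)
qed

section \<open>Outputs of the subroutine\<close>

lemma expansion_steps_grid:
  assumes "expansion_steps p E a lam zs x x'" "set zs \<subseteq> grid \<delta>" "x \<in> grid_vec p \<delta>"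
  shows "x' \<in> grid_vec p \<delta>"
  using assms
proof (induction zs arbitrary: x)
  case (Cons z zs)
  then obtain x'' where x'': "expansion_step p E a lam z x x''" "expansion_steps p E a lam zs x'' x'"
    by auto
  have "x'' \<in> grid_vec p \<delta>"
    using x''(1) Cons.prems by (auto simp: expansion_step_def grid_vec_def)
  with Cons.IH[OF x''(2)] Cons.prems show ?case by simp
qed simp

lemma alpha_expansion_grid:
  assumes "alpha_expansion p E a lam \<delta> x"
  shows "x \<in> grid_vec p \<delta>"
proof -
  from assms obtain x\<^sub>0 where "(sweep p E a lam \<delta>)\<^sup>*\<^sup>* x\<^sub>0 x" "x\<^sub>0 \<in> grid_vec p \<delta>"
    by (auto simp: alpha_expansion_def)
  then show ?thesis
  proof (induction rule: rtranclp_induct)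
    case (step x' x'')
    from step(2) obtain zs where "set zs = labels p a \<delta>" "expansion_steps p E a lam zs x' x''"
      by (auto simp: sweep_def)
    then show ?case using step by (intro expansion_steps_grid[of p E a lam zs x' x'']) (auto simp: labels_def)
  qed
qed

text \<open>A final sweep only tests labels in the range of \<open>a\<close>. A minimizer with such
  labels can be compared by the fixpoint bound, and its minimality carries the bound to the whole
  grid.\<close>

lemma alpha_expansion_guarantee:
  assumes G: "simple_graph p E" and lam: "lam \<ge> 0" and a: "a \<in> carrier_vec p"
    and x: "alpha_expansion p E a lam \<delta> x" and suff: "labels_suffice p E a lam \<delta>"
  shows "alpha_guarantee p E a lam \<delta> x"
proof -
  from suff obtain m where m: "m \<in> grid_vec p \<delta>" "\<And>i. i < p \<Longrightarrow> m $ i \<in> labels p a \<delta>"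
    "\<And>v. v \<in> grid_vec p \<delta> \<Longrightarrow> l0_objective E a (2 * lam) m \<le> l0_objective E a (2 * lam) v"
    by (auto simp: labels_suffice_def)
  have "l0_objective E a lam x \<le> l0_objective E a (2 * lam) m"
    using x m alpha_expansion_grid[OF x]
    by (intro expansion_fixpoint_le[OF G lam _ a]) (auto simp: alpha_expansion_def grid_vec_def)
  with m(3) show ?thesis by (force simp: alpha_guarantee_def)
qed

section \<open>Consequences of cRIP\<close>

text \<open>Three slots serve the combinations of new iterate, old iterate and signal; the zero
  vector fills a spare slot.\<close>

lemma grad_l0_le_add:
  assumes G: "simple_graph p E"
    and eq: "\<And>i j. i < p \<Longrightarrow> j < p \<Longrightarrow> u $ i = u $ j \<Longrightarrow> v $ i = v $ j \<Longrightarrow> w $ i = w $ j \<Longrightarrow> x $ i = x $ j"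
  shows "grad_l0 E x \<le> grad_l0 E u + grad_l0 E v + grad_l0 E w"
proof -
  have fin: "finite E" using simple_graph_finite[OF G] .
  have "real (grad_l0 E x) \<le> real (grad_l0 E u) + real (grad_l0 E v) + real (grad_l0 E w)"
    unfolding grad_l0_eq_sum[OF fin] sum.distrib[symmetric]
  proof (rule sum_mono)
    fix e assume "e \<in> E"
    from simple_graph_edgeE[OF G this] obtain i j where "e = {i, j}" "i < j" "j < p" .
    then show "edge_cut x e \<le> edge_cut u e + edge_cut v e + edge_cut w e"
      using eq[of i j] by (auto simp: edge_cut_pair)
  qed
  then show ?thesis by linarith
qed

lemma grad_l0_zero [simp]: "simple_graph p E \<Longrightarrow> grad_l0 E (0\<^sub>v p) = 0"
  unfolding grad_l0_def simple_graph_def card_eq_0_iff by (fastforce simp: subset_iff)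

lemma grad_l0_eq_0_constant:
  assumes "simple_graph p E" "connected_graph p E" "grad_l0 E v = 0" "i < p" "j < p"
  shows "v $ i = v $ j"
proof -
  have none: "{e \<in> E. \<exists>i j. e = {i, j} \<and> v $ i \<noteq> v $ j} = {}"
    using assms(3) simple_graph_finite[OF assms(1)] by (simp add: grad_l0_def)
  have "(i, j) \<in> {(u, v). {u, v} \<in> E}\<^sup>*"
    using assms by (auto simp: connected_graph_def)
  then show ?thesis
    by (induction rule: rtrancl_induct) (use none in auto)
qed

lemma isometry_bounds_mono:
  assumes "isometry_bounds B \<kappa> r x" "r \<le> r'"
  shows "isometry_bounds B \<kappa> r' x"
proof -
  have "sqrt r * l2norm x \<le> sqrt r' * l2norm x"
    using assms(2) by (intro mult_right_mono) auto
  then show ?thesis using assms(1) by (simp add: isometry_bounds_def algebra_simps)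
qed

text \<open>
  Constant vectors lie outside cRIP. They are multiples of the signal if that is constant, and limits
  of vectors with the gradient support of the signal otherwise.
\<close>

lemma cRIP_isometry_bounds:
  assumes G: "simple_graph p E" and conn: "connected_graph p E"
    and B: "B \<in> carrier_mat n p" and \<rho>: "crip_function \<rho>" and crip: "cRIP p E \<kappa> \<rho> B"
    and xs: "xs \<in> carrier_vec p" "xs \<noteq> 0\<^sub>v p" and s: "s = max (grad_l0 E xs) 1"
    and iso: "isometry_bounds B \<kappa> (\<rho> (real s)) xs"
    and v: "v \<in> carrier_vec p" and m: "real (grad_l0 E v) \<le> m" "real s \<le> m"
  shows "isometry_bounds B \<kappa> (\<rho> m) v"
proof (cases "grad_l0 E v \<ge> 1")
  case True
  then have "isometry_bounds B \<kappa> (\<rho> (real (grad_l0 E v))) v"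
    using crip v by (simp add: cRIP_def)
  then show ?thesis
    using True m by (elim isometry_bounds_mono) (intro crip_function_mono[OF \<rho>], auto)
next
  case False
  then have v_const: "v $ i = v $ j" if "i < p" "j < p" for i j
    using grad_l0_eq_0_constant[OF G conn _ that] by simp
  have "isometry_bounds B \<kappa> (\<rho> (real s)) v"
  proof (cases "grad_l0 E xs = 0")
    case True
    obtain i where i: "i < p" "xs $ i \<noteq> 0"
      using xs by (metis carrier_vecD eq_vecI index_zero_vec)
    have eq: "v = (v $ i / xs $ i) \<cdot>\<^sub>v xs"
    proof (rule eq_vecI)
      fix j assume "j < dim_vec ((v $ i / xs $ i) \<cdot>\<^sub>v xs)"
      then have "j < p" using xs by simp
      then show "v $ j = ((v $ i / xs $ i) \<cdot>\<^sub>v xs) $ j"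
        using v_const[of j i] grad_l0_eq_0_constant[OF G conn True, of j i] i xs by simp
    qed (use v xs in simp)
    have "isometry_bounds B \<kappa> r (d \<cdot>\<^sub>v xs)" if "isometry_bounds B \<kappa> r xs" for d r
    proof -
      have Bd: "B *\<^sub>v (d \<cdot>\<^sub>v xs) = d \<cdot>\<^sub>v (B *\<^sub>v xs)" using mult_mat_vec[OF B xs(1)] .
      show ?thesis
        using mult_left_mono[of "(1 - \<kappa> - sqrt r) * l2norm xs" "l2norm (B *\<^sub>v xs)" "\<bar>d\<bar>"]
          mult_left_mono[of "l2norm (B *\<^sub>v xs)" "(1 + \<kappa> + sqrt r) * l2norm xs" "\<bar>d\<bar>"] that
        unfolding isometry_bounds_def Bd l2norm_smult by (simp add: mult.left_commute)
    qed
    from this[OF iso] show ?thesis by (subst eq)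
  next
    case False
    \<comment> \<open>Since \<open>v\<close> is constant, \<open>w h\<close> has the cut edges of
      \<open>xs\<close> for every nonzero \<open>h\<close>, so cRIP applies to it, and h
      \<rightarrow> 0 gives the bounds for \<open>v\<close>. The factor 1 brings \<open>w h\<close>
      into the form of the expansion lemmas.\<close>
    define w where "w h = 1 \<cdot>\<^sub>v v + h \<cdot>\<^sub>v xs" for h
    have w: "w h \<in> carrier_vec p" for h using v xs by (simp add: w_def)
    have grad: "grad_l0 E (w h) = grad_l0 E xs" if "h \<noteq> 0" for h
      unfolding grad_l0_def
    proof (intro arg_cong[of _ _ card] Collect_cong conj_cong refl ex_cong1)
      fix e i j assume "e \<in> E" "e = {i, j}"
      then have "i < p" "j < p" using G by (auto simp: simple_graph_def)
      then show "(w h $ i \<noteq> w h $ j) = (xs $ i \<noteq> xs $ j)"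
        using v_const[of i j] v xs that by (simp add: w_def)
    qed
    have Bv: "B *\<^sub>v v \<in> carrier_vec n" "B *\<^sub>v xs \<in> carrier_vec n" using B v xs by auto
    have lim: "((\<lambda>h. l2norm (w h)) \<longlongrightarrow> l2norm v) (at_right 0)"
      unfolding w_def l2norm_def scalar_prod_lincomb[OF v xs(1)]
      by (rule tendsto_eq_intros refl | simp)+
    have limB: "((\<lambda>h. l2norm (B *\<^sub>v w h)) \<longlongrightarrow> l2norm (B *\<^sub>v v)) (at_right 0)"
      unfolding w_def l2norm_def mult_mat_vec_lincomb[OF B v xs(1)] scalar_prod_lincomb[OF Bv]
      by (rule tendsto_eq_intros refl | simp)+
    have "isometry_bounds B \<kappa> (\<rho> (real s)) (w h)" if "h > 0" for h
      using crip w[of h] grad[of h] that False s by (auto simp: cRIP_def)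
    then have ev: "\<forall>\<^sub>F h in at_right 0. isometry_bounds B \<kappa> (\<rho> (real s)) (w h)"
      by (auto simp: eventually_at_right_less intro: eventually_mono[OF eventually_at_right_less])
    show ?thesis
      unfolding isometry_bounds_def
    proof
      show "(1 - \<kappa> - sqrt (\<rho> (real s))) * l2norm v \<le> l2norm (B *\<^sub>v v)"
        by (rule tendsto_le[OF _ limB tendsto_mult_left[OF lim]])
          (use ev in \<open>auto elim: eventually_mono simp: isometry_bounds_def\<close>)
      show "l2norm (B *\<^sub>v v) \<le> (1 + \<kappa> + sqrt (\<rho> (real s))) * l2norm v"
        by (rule tendsto_le[OF _ tendsto_mult_left[OF lim] limB])
          (use ev in \<open>auto elim: eventually_mono simp: isometry_bounds_def\<close>)
    qed
  qed
  then show ?thesis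
    using m s by (elim isometry_bounds_mono) (intro crip_function_mono[OF \<rho>], auto)
qed

text \<open>Around \<open>a\<close> the two data terms are half the squares of \<open>r' - w\<close>
  and \<open>w\<close>, where \<open>w = a - xs\<close>. The square of \<open>w\<close> cancels, and
  \<open>r' \<bullet> w\<close> is the difference of inner products because \<open>w\<close> is
  \<open>r\<close> minus \<eta> times the Gram matrix of \<open>A\<close> applied to
  \<open>r\<close>.\<close>

lemma guarantee_residual:
  fixes A :: "real mat"
  assumes A: "A \<in> carrier_mat n p" and \<eta>: "\<eta> > 0"
    and x: "x \<in> carrier_vec p" and x': "x' \<in> carrier_vec p" and xs: "xs \<in> grid_vec p \<delta>"
    and a: "a = x - \<eta> \<cdot>\<^sub>v (transpose_mat A *\<^sub>v (A *\<^sub>v x - A *\<^sub>v xs))"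
    and guarantee: "alpha_guarantee p E a lam \<delta> x'"
    and B: "B = sqrt \<eta> \<cdot>\<^sub>m A"
  shows "1/2 * (l2norm (x' - xs))\<^sup>2 + lam * real (grad_l0 E x')
    \<le> (x' - xs) \<bullet> (x - xs) - (B *\<^sub>v (x' - xs)) \<bullet> (B *\<^sub>v (x - xs)) + 2 * lam * real (grad_l0 E xs)"
proof -
  have xsc: "xs \<in> carrier_vec p" using xs by (simp add: grid_vec_def)
  define r r' u where "r = x - xs" and "r' = x' - xs" and "u = transpose_mat A *\<^sub>v (A *\<^sub>v r)"
  define w where "w = 1 \<cdot>\<^sub>v r + (- \<eta>) \<cdot>\<^sub>v u"
  have c: "r \<in> carrier_vec p" "r' \<in> carrier_vec p" "u \<in> carrier_vec p" "w \<in> carrier_vec p"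
    using x x' xsc A by (auto simp: r_def r'_def u_def w_def)
  have Ar: "A *\<^sub>v x - A *\<^sub>v xs = A *\<^sub>v r"
    unfolding r_def by (rule mult_minus_distrib_mat_vec[OF A x xsc, symmetric])
  have aw: "a = x - \<eta> \<cdot>\<^sub>v u" unfolding a Ar u_def ..
  have "x' - a = 1 \<cdot>\<^sub>v r' + (- 1) \<cdot>\<^sub>v w"
    using c x x' xsc unfolding aw by (intro eq_vecI) (auto simp: w_def r_def r'_def)
  then have 1: "(l2norm (x' - a))\<^sup>2 = (l2norm r')\<^sup>2 - 2 * (r' \<bullet> w) + w \<bullet> w"
    by (simp only: l2norm_power2 scalar_prod_lincomb[OF c(2,4)]) simp
  have "xs - a = (- 1) \<cdot>\<^sub>v w"
    using c x xsc unfolding aw by (intro eq_vecI) (auto simp: w_def r_def)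
  then have 2: "(l2norm (xs - a))\<^sup>2 = w \<bullet> w"
    by (simp only: l2norm_smult power_mult_distrib l2norm_power2) simp
  have "r' \<bullet> u = (A *\<^sub>v r') \<bullet> (A *\<^sub>v r)"
    unfolding u_def using transpose_vec_mult_scalar[OF A c(2), of "A *\<^sub>v r"] c A
    by (simp add: comm_scalar_prod[of _ p] comm_scalar_prod[of _ n])
  moreover have "r' \<bullet> w = r' \<bullet> r - \<eta> * (r' \<bullet> u)"
    using c by (simp add: w_def scalar_prod_add_distrib[of _ p])
  moreover have "B *\<^sub>v q = sqrt \<eta> \<cdot>\<^sub>v (A *\<^sub>v q)" if "q \<in> carrier_vec p" for q
    using that A by (intro eq_vecI) (auto simp: B)
  ultimately have 3: "r' \<bullet> w = r' \<bullet> r - (B *\<^sub>v r') \<bullet> (B *\<^sub>v r)"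
    using \<eta> c A by (simp add: real_sqrt_mult_self flip: mult.assoc)
  have "l0_objective E a lam x' \<le> l0_objective E a (2 * lam) xs"
    using guarantee xs by (simp add: alpha_guarantee_def)
  then show ?thesis
    unfolding l0_objective_def 1 2 3 by (fold r_def r'_def) (simp add: add_divide_distrib diff_divide_distrib)
qed

section \<open>Convergence of ITALE\<close>

text \<open>Turns the quadratic inequality of one iteration into a linear recursion: were the claim
  false, both factors of (u - 2 b) u would exceed 2 X.\<close>

lemma le_if_square_le:
  fixes u X b :: real
  assumes "0 \<le> X" "0 \<le> b" "1/2 * u\<^sup>2 \<le> b * u + 2 * X\<^sup>2"
  shows "u \<le> 2 * b + 2 * X"
proof (rule ccontr)
  assume "\<not> ?thesis"
  then have u: "2 * X < u - 2 * b" "2 * X < u" using assms by auto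
  then have "(2 * X) * (2 * X) < (u - 2 * b) * u" using assms by (intro mult_strict_mono') auto
  then show False using assms(3) by (simp add: power2_eq_square algebra_simps)
qed

text \<open>
  The sparsity of \<open>x'\<close> enters its own isometry constant. A crude Cauchy-Schwarz estimate, in which
  \<open>\<rho>\<close> occurs only linearly, bounds that sparsity first; only then is polarization applied.
\<close>

lemma iteration_step:
  fixes B :: "real mat"
  assumes \<kappa>: "0 \<le> \<kappa>" "\<kappa> \<le> 1/4" and t: "t = 1 - 4 * \<kappa> - 2 * \<kappa>\<^sup>2" "t > 0"
    and C: "C = 8 / t" and D: "D = 6 + 98 * C\<^sup>2" and c: "c = (t / 14)\<^sup>2 / (2 * D)"
    and G: "simple_graph p E" and B: "B \<in> carrier_mat n p"
    and x: "x \<in> carrier_vec p" and x': "x' \<in> carrier_vec p" and xs: "xs \<in> carrier_vec p"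
    and s: "s > 0" "real (grad_l0 E xs) \<le> s" and lam: "lam > 0"
    and iso: "\<And>v m. v \<in> carrier_vec p \<Longrightarrow> real (grad_l0 E v) \<le> m \<Longrightarrow> s \<le> m
      \<Longrightarrow> isometry_bounds B \<kappa> (m / s * c) v"
    and obj: "1/2 * (l2norm (x' - xs))\<^sup>2 + lam * real (grad_l0 E x')
      \<le> (x' - xs) \<bullet> (x - xs) - (B *\<^sub>v (x' - xs)) \<bullet> (B *\<^sub>v (x - xs)) + 2 * lam * real (grad_l0 E xs)"
    and R: "l2norm (x - xs) \<le> C * sqrt (lam * s)" and sparse: "real (grad_l0 E x) + s \<le> D * s"
  shows "l2norm (x' - xs) \<le> (1 - t / 4) * (C * sqrt (lam * s))" "real (grad_l0 E x') + s \<le> D * s"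
proof -
  define u v where "u = x' - xs" and "v = x - xs"
  define X q where "X = sqrt (lam * s)" and "q = (real (grad_l0 E x') + s) / s"
  have uv: "u \<in> carrier_vec p" "v \<in> carrier_vec p" using x x' xs by (auto simp: u_def v_def)
  have Buv: "B *\<^sub>v u \<in> carrier_vec n" "B *\<^sub>v v \<in> carrier_vec n" using B uv by auto
  have X2: "X\<^sup>2 = lam * s" and X0: "X \<ge> 0" using lam s by (simp_all add: X_def)
  have t1: "t \<le> 1" using \<kappa> t(1) zero_le_power2[of \<kappa>] by linarith
  have C0: "C > 0" and D6: "D \<ge> 6" using t C D by auto
  have cD: "D * c = (t / 14)\<^sup>2 / 2" using D6 by (simp add: c)
  have t2: "t\<^sup>2 \<le> 1" using t1 t by (simp add: power_le_one)
  have c0: "c > 0" using t D6 by (simp add: c)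
  have Rv: "l2norm v \<le> C * X" using R by (simp add: v_def X_def)
  have R2: "(l2norm v)\<^sup>2 \<le> C\<^sup>2 * (lam * s)"
    using power_mono[OF Rv, of 2] by (simp add: power_mult_distrib X2)
  have grad_xs: "2 * lam * real (grad_l0 E xs) \<le> 2 * lam * s" using s lam by simp
  note obj' = obj[folded u_def v_def]

  have "q \<le> D"
  proof -
    \<comment> \<open>\<open>q\<close> is the bound on the sparsity of \<open>u\<close> in units of
      \<open>s\<close>, and \<open>h\<close> below is the resulting square root term in its isometry
      bound.\<close>
    have q1: "q \<ge> 1" and qs: "q * s = real (grad_l0 E x') + s" using s by (simp_all add: q_def)
    define h where "h = sqrt (q * c)"
    have h2: "h\<^sup>2 = q * c" and h0: "h \<ge> 0" using q1 c0 by (simp_all add: h_def)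
    have "grad_l0 E v \<le> grad_l0 E x + grad_l0 E xs + grad_l0 E (0\<^sub>v p)"
      unfolding v_def using x xs by (intro grad_l0_le_add[OF G]) auto
    then have "isometry_bounds B \<kappa> (D * s / s * c) v"
      using sparse s D6 G by (intro iso uv) (auto simp: mult_right_mono)
    then have "l2norm (B *\<^sub>v v) \<le> (1 + \<kappa> + sqrt (D * c)) * l2norm v"
      using s by (simp add: isometry_bounds_def)
    also have "\<dots> \<le> 3 * l2norm v"
      using \<kappa> t2 by (intro mult_right_mono) (auto simp: cD power_divide real_sqrt_le_1_iff
        intro!: order_trans[OF add_mono[OF order_refl, of "sqrt _" 1]])
    finally have Bv: "l2norm (B *\<^sub>v v) \<le> 3 * l2norm v" .
    have "grad_l0 E u \<le> grad_l0 E x' + grad_l0 E xs + grad_l0 E (0\<^sub>v p)"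
      unfolding u_def using x' xs by (intro grad_l0_le_add[OF G]) auto
    then have "isometry_bounds B \<kappa> (q * s / s * c) u"
      using s q1 G by (intro iso uv) (auto simp: qs)
    then have "l2norm (B *\<^sub>v u) \<le> (1 + \<kappa> + h) * l2norm u"
      using s by (simp add: isometry_bounds_def h_def)
    also have "\<dots> \<le> (2 + h) * l2norm u"
      using \<kappa> by (intro mult_right_mono) auto
    finally have Bu: "l2norm (B *\<^sub>v u) \<le> (2 + h) * l2norm u" .
    have "u \<bullet> v - (B *\<^sub>v u) \<bullet> (B *\<^sub>v v) \<le> l2norm u * l2norm v + l2norm (B *\<^sub>v u) * l2norm (B *\<^sub>v v)"
      using l2norm_Cauchy_Schwarz[OF uv] l2norm_Cauchy_Schwarz[OF Buv] by linarith
    also have "\<dots> \<le> l2norm u * l2norm v + ((2 + h) * l2norm u) * (3 * l2norm v)"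
      using Bu Bv h0 by (intro add_left_mono mult_mono) auto
    also have "\<dots> = l2norm u * ((7 + 3 * h) * l2norm v)" by (simp add: algebra_simps)
    \<comment> \<open>The half square of \<open>u\<close> is split off to cancel the one on the left
      of \<open>obj'\<close>, leaving a bound on sparsity alone.\<close>
    also have "\<dots> \<le> 1/2 * (l2norm u)\<^sup>2 + 1/2 * ((7 + 3 * h) * l2norm v)\<^sup>2"
      using sum_squares_bound[of "l2norm u" "(7 + 3 * h) * l2norm v"] by (simp add: algebra_simps)
    finally have "lam * real (grad_l0 E x') \<le> 1/2 * ((7 + 3 * h)\<^sup>2 * (l2norm v)\<^sup>2) + 2 * lam * s"
      using obj' grad_xs by (simp add: power_mult_distrib)
    also have "(7 + 3 * h)\<^sup>2 * (l2norm v)\<^sup>2 \<le> (98 + 18 * h\<^sup>2) * (C\<^sup>2 * (lam * s))"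
      using R2 sum_squares_bound[of 7 "3 * h"]
      by (intro mult_mono) (auto simp: power2_eq_square algebra_simps)
    finally have "lam * (s * (q - 1)) \<le> lam * (s * ((49 + 9 * h\<^sup>2) * C\<^sup>2 + 2))"
      using qs by (simp add: algebra_simps)
    then have "q - 1 \<le> (49 + 9 * h\<^sup>2) * C\<^sup>2 + 2"
      using lam s by (simp only: mult_le_cancel_left_pos)
    \<comment> \<open>As \<open>h\<^sup>2 = q * c\<close> is linear in \<open>q\<close>, a small
      \<open>c\<close> lets half of \<open>q\<close> absorb it; solving for \<open>q\<close> gives
      exactly \<open>D\<close>.\<close>
    moreover have "9 * h\<^sup>2 * C\<^sup>2 \<le> q / 2"
    proof -
      have "98 * C\<^sup>2 * c \<le> D * c" using c0 by (intro mult_right_mono) (auto simp: D)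
      then have "18 * (C\<^sup>2 * c) \<le> 1" using t2 by (simp add: cD power_divide)
      then have "q * (18 * (C\<^sup>2 * c)) \<le> q * 1" using q1 by (intro mult_left_mono) auto
      then show ?thesis by (simp add: h2 algebra_simps)
    qed
    ultimately show "q \<le> D" by (simp add: D algebra_simps)
  qed
  then show sparse': "real (grad_l0 E x') + s \<le> D * s"
    using s by (simp add: q_def pos_divide_le_eq)

  define \<epsilon> where "\<epsilon> = 1/2 - t / 4"
  have \<epsilon>0: "\<epsilon> \<ge> 0" using t1 by (simp add: \<epsilon>_def)
  have \<epsilon>: "2 * (\<kappa> + t / 14) + (\<kappa> + t / 14)\<^sup>2 \<le> \<epsilon>"
  proof -
    \<comment> \<open>Since 2 \<kappa> + \<kappa>^2 = (1 - t)/2, the excess over it is t/7 + z, and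
      1/7 + 1/28 + 1/196 is below the available 1/4.\<close>
    define z w where "z = (\<kappa> / 7 + t / 196) * t" and "w = 2 * (\<kappa> + t / 14) + (\<kappa> + t / 14)\<^sup>2"
    have "z \<le> (1 / 28 + 1 / 196) * t"
      unfolding z_def using \<kappa>(2) t1 t(2) by (intro mult_right_mono) auto
    moreover have "w = 1/2 - t / 2 + t / 7 + z"
      by (simp add: z_def w_def t(1) power2_eq_square field_simps)
    ultimately have "w \<le> \<epsilon>" using t(2) by (simp add: \<epsilon>_def)
    then show ?thesis by (simp only: w_def)
  qed
  have "u \<bullet> v - (B *\<^sub>v u) \<bullet> (B *\<^sub>v v) \<le> \<epsilon> * (l2norm u * l2norm v)"
  proof (rule near_isometry_scalar_prod[OF B uv])
    fix a b
    let ?w = "a \<cdot>\<^sub>v u + b \<cdot>\<^sub>v v"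
    have "grad_l0 E ?w \<le> grad_l0 E x' + grad_l0 E x + grad_l0 E xs"
      unfolding u_def v_def using x x' xs by (intro grad_l0_le_add[OF G]) auto
    \<comment> \<open>Each iterate has sparsity at most (D - 1) s and the signal at most s, so 2 D s
      bounds the sum.\<close>
    then have "isometry_bounds B \<kappa> (2 * D * s / s * c) ?w"
      using sparse sparse' s D6 uv by (intro iso) auto
    moreover have "2 * D * s / s * c = (t / 14)\<^sup>2" using s cD by simp
    ultimately have "isometry_bounds B \<kappa> ((t / 14)\<^sup>2) ?w" by simp
    then show "\<bar>(l2norm ?w)\<^sup>2 - (l2norm (B *\<^sub>v ?w))\<^sup>2\<bar> \<le> \<epsilon> * (l2norm ?w)\<^sup>2"
      using \<kappa> t \<epsilon> by (intro isometry_bounds_power2[of B \<kappa> "(t / 14)\<^sup>2"]) (auto simp: real_sqrt_abs)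
  qed
  moreover have "0 \<le> lam * real (grad_l0 E x')" using lam by simp
  ultimately have "1/2 * (l2norm u)\<^sup>2 \<le> (\<epsilon> * l2norm v) * l2norm u + 2 * X\<^sup>2"
    using obj' grad_xs unfolding X2 by (simp add: algebra_simps)
  then have "l2norm u \<le> 2 * (\<epsilon> * l2norm v) + 2 * X"
    using X0 \<epsilon>0 by (intro le_if_square_le) auto
  also have "\<dots> \<le> 2 * (\<epsilon> * (C * X)) + 2 * X"
    using Rv \<epsilon>0 by (simp add: mult_left_mono)
  also have "\<dots> = (1 - t / 4) * (C * X)"
    using t by (simp add: \<epsilon>_def C field_simps)
  finally show "l2norm (x' - xs) \<le> (1 - t / 4) * (C * sqrt (lam * s))"
    by (simp add: u_def X_def)
qed

text \<open>Each iteration satisfies the guarantee, by the min-cut argument where the labels suffice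
  and by \<open>guar\<close> elsewhere. Positivity of \<open>lam k\<close> is read off the stopping
  rule.\<close>

lemma ITALE_run_iterates:
  assumes run: "ITALE_run p E A y \<gamma> lam_max lam_min \<eta> \<delta> K lam a x"
    and "lam_min > 0" and G: "simple_graph p E" and A: "A \<in> carrier_mat n p"
    and y: "y \<in> carrier_vec n"
    and guar: "\<forall>k<K. \<not> labels_suffice p E (a (Suc k)) (lam k) \<delta> \<longrightarrow>
      alpha_guarantee p E (a (Suc k)) (lam k) \<delta> (x (Suc k))"
  shows "k \<le> K \<Longrightarrow> lam k = lam_max * \<gamma> ^ k" "k \<le> K \<Longrightarrow> x k \<in> grid_vec p \<delta>"
    "k < K \<Longrightarrow> lam k > 0" "k < K \<Longrightarrow> alpha_guarantee p E (a (Suc k)) (lam k) \<delta> (x (Suc k))"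
proof -
  have step: "lam k \<ge> lam_min" "lam (Suc k) = \<gamma> * lam k"
    "a (Suc k) = x k - \<eta> \<cdot>\<^sub>v (transpose_mat A *\<^sub>v (A *\<^sub>v x k - y))"
    "alpha_expansion p E (a (Suc k)) (lam k) \<delta> (x (Suc k))" if "k < K" for k
    using run that by (auto simp: ITALE_run_def)
  have init: "x 0 = 0\<^sub>v p" "lam 0 = lam_max" using run by (auto simp: ITALE_run_def)
  show "k \<le> K \<Longrightarrow> lam k = lam_max * \<gamma> ^ k"
    by (induction k) (auto simp: init step(2))
  have "0 \<in> grid \<delta>" unfolding grid_def by (auto intro: exI[of _ 0])
  then have grid: "x k \<in> grid_vec p \<delta>" if "k \<le> K" for k
    using that
  proof (cases k)
    case (Suc j)
    then show ?thesis using that alpha_expansion_grid[OF step(4)[of j]] by simp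
  qed (simp add: init(1) grid_vec_def)
  then show "k \<le> K \<Longrightarrow> x k \<in> grid_vec p \<delta>" .
  show pos: "lam k > 0" if "k < K" for k using step(1)[OF that] assms(2) by linarith
  show "alpha_guarantee p E (a (Suc k)) (lam k) \<delta> (x (Suc k))" if k: "k < K"
  proof (cases "labels_suffice p E (a (Suc k)) (lam k) \<delta>")
    case True
    have "a (Suc k) \<in> carrier_vec p"
      using grid[of k] k A y by (auto simp: step(3) grid_vec_def)
    then show ?thesis
      using alpha_expansion_guarantee[OF G _ _ step(4)[OF k] True] pos[OF k] by simp
  qed (use guar k in blast)
qed

text \<open>Distinct grid vectors differ by a nonzero multiple of \<delta> in some
  coordinate.\<close>

lemma grid_vec_eqI:
  assumes "u \<in> grid_vec p \<delta>" "v \<in> grid_vec p \<delta>" "l2norm (u - v) < \<delta>"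
  shows "u = v"
proof (rule eq_vecI)
  have c: "u \<in> carrier_vec p" "v \<in> carrier_vec p" using assms by (auto simp: grid_vec_def)
  show "dim_vec u = dim_vec v" using c by simp
  fix i assume "i < dim_vec v"
  then have i: "i < p" using c by simp
  obtain k l :: int where kl: "u $ i = of_int k * \<delta>" "v $ i = of_int l * \<delta>"
    using assms(1,2) i unfolding grid_vec_def grid_def by blast
  have \<delta>: "\<delta> > 0" using assms(3) l2norm_nonneg[of "u - v"] by linarith
  have "\<bar>(u - v) $ i\<bar> < \<delta>"
    using abs_index_le_l2norm[of "u - v" p i] c i assms(3) by simp
  moreover have "(u - v) $ i = of_int (k - l) * \<delta>"
    using c i by (simp add: kl algebra_simps)
  ultimately have "\<bar>real_of_int (k - l)\<bar> * \<delta> < 1 * \<delta>" using \<delta> by (simp add: abs_mult)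
  then have "\<bar>real_of_int (k - l)\<bar> < 1" using \<delta> by (simp only: mult_less_cancel_right_pos)
  then have "k = l" by linarith
  then show "u $ i = v $ i" by (simp add: kl)
qed

text \<open>Error and sparsity are carried through one induction, since each step uses both bounds
  to reproduce them.\<close>

lemma ITALE_error_bound:
  assumes \<kappa>: "0 \<le> \<kappa>" "\<kappa> \<le> 1/4" and t: "t = 1 - 4 * \<kappa> - 2 * \<kappa>\<^sup>2" "t > 0"
    and C: "C = 8 / t" and D: "D = 6 + 98 * C\<^sup>2" and c: "c = (t / 14)\<^sup>2 / (2 * D)"
    and G: "simple_graph p E" and conn: "connected_graph p E" and A: "A \<in> carrier_mat n p"
    and \<eta>: "\<eta> > 0" and xs: "xs \<in> grid_vec p \<delta>" and s: "s = max (grad_l0 E xs) 1"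
    and \<rho>: "crip_function \<rho>" "\<rho> (real s) \<le> c" and crip: "cRIP p E \<kappa> \<rho> (sqrt \<eta> \<cdot>\<^sub>m A)"
    and iso: "isometry_bounds (sqrt \<eta> \<cdot>\<^sub>m A) \<kappa> (\<rho> (real s)) xs"
    and \<gamma>: "(1 - t / 4)\<^sup>2 < \<gamma>" and lam_max: "lam_max > (l2norm xs)\<^sup>2"
    and lam_min: "lam_min > 0"
    and run: "ITALE_run p E A (A *\<^sub>v xs) \<gamma> lam_max lam_min \<eta> \<delta> K lam a x"
    and guar: "\<forall>k<K. \<not> labels_suffice p E (a (Suc k)) (lam k) \<delta> \<longrightarrow>
      alpha_guarantee p E (a (Suc k)) (lam k) \<delta> (x (Suc k))"
    and k: "k \<le> K"
  shows "l2norm (x k - xs) \<le> C * sqrt (lam_max * real s) * sqrt \<gamma> ^ k"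
proof -
  define B where "B = sqrt \<eta> \<cdot>\<^sub>m A"
  have B: "B \<in> carrier_mat n p" using A by (simp add: B_def)
  have xsc: "xs \<in> carrier_vec p" using xs by (simp add: grid_vec_def)
  have y: "A *\<^sub>v xs \<in> carrier_vec n" using A xsc by simp
  note it = ITALE_run_iterates[OF run lam_min G A y guar]
  have xc: "x k \<in> carrier_vec p" if "k \<le> K" for k using it(2)[OF that] by (simp add: grid_vec_def)
  have x0: "x 0 = 0\<^sub>v p" using run by (simp add: ITALE_run_def)
  have s1: "s \<ge> 1" using s by simp
  have t1: "t \<le> 1" using \<kappa> t(1) zero_le_power2[of \<kappa>] by linarith
  have C8: "C \<ge> 8" using t t1 by (simp add: C pos_le_divide_eq)
  have lm: "lam_max > 0" using lam_max zero_le_power2[of "l2norm xs"] by linarith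
  have obj: "1/2 * (l2norm (x (Suc k) - xs))\<^sup>2 + lam k * real (grad_l0 E (x (Suc k)))
    \<le> (x (Suc k) - xs) \<bullet> (x k - xs) - (B *\<^sub>v (x (Suc k) - xs)) \<bullet> (B *\<^sub>v (x k - xs))
      + 2 * lam k * real (grad_l0 E xs)" if "k < K" for k
    using run that xc[of k] xc[of "Suc k"] it(4)[OF that]
    by (intro guarantee_residual[OF A \<eta> _ _ xs _ _ B_def]) (auto simp: ITALE_run_def)
  show ?thesis
  proof (cases "xs = 0\<^sub>v p")
    \<comment> \<open>A zero signal gives no isometry bound for constant vectors. Here the residual
      stays 0: comparison with the signal bounds the objective terms by 0, so the next iterate
      vanishes as well.\<close>
    case True
    have "x k = 0\<^sub>v p"
      using k
    proof (induction k)
      case (Suc k)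
      have "B *\<^sub>v 0\<^sub>v p = 0\<^sub>v n" using B by (intro eq_vecI) auto
      moreover have "x (Suc k) \<in> carrier_vec p" using xc Suc.prems by blast
      moreover have "0 \<le> lam k * real (grad_l0 E (x (Suc k)))" using it(3)[of k] Suc.prems by simp
      moreover have "1/2 * (l2norm (x (Suc k)))\<^sup>2 + lam k * real (grad_l0 E (x (Suc k))) \<le> 0"
        using calculation obj[of k] Suc True G B by simp
      ultimately have "(l2norm (x (Suc k)))\<^sup>2 \<le> 0" by linarith
      then have "l2norm (x (Suc k)) = 0" by simp
      then show ?case using l2norm_eq_0_iff xc[OF Suc.prems] by auto
    qed (rule x0)
    then show ?thesis using True C8 lm t \<gamma> l2norm_eq_0_iff[of "0\<^sub>v p" p]
      by (simp add: order_trans[OF zero_le_power2 less_imp_le[OF \<gamma>]])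
  next
    case False
    \<comment> \<open>The linear majorant of \<rho> from concavity, with \<open>c\<close> in place
      of \<open>\<rho> s\<close>, is the form that one iteration consumes.\<close>
    have iso': "isometry_bounds B \<kappa> (m / real s * c) v"
      if "v \<in> carrier_vec p" "real (grad_l0 E v) \<le> m" "real s \<le> m" for v m
    proof (rule isometry_bounds_mono)
      show "isometry_bounds B \<kappa> (\<rho> m) v"
        using cRIP_isometry_bounds[OF G conn B \<rho>(1) _ xsc False s _ that] crip iso by (simp add: B_def)
      have "\<rho> m \<le> m / real s * \<rho> (real s)"
        using crip_function_le_linear[OF \<rho>(1)] s1 that by simp
      also have "\<dots> \<le> m / real s * c" using \<rho>(2) s1 that by (intro mult_left_mono) auto
      finally show "\<rho> m \<le> m / real s * c" .
    qed
    have "l2norm (x k - xs) \<le> C * sqrt (lam_max * real s) * sqrt \<gamma> ^ k \<and> real (grad_l0 E (x k)) + real s \<le> D * real s"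
      using k
    proof (induction k)
      case 0
      \<comment> \<open>The run starts at 0 with error \<open>l2norm xs\<close>, which the lower
        bound on \<open>lam_max\<close> controls.\<close>
      have "x 0 - xs = (-1) \<cdot>\<^sub>v xs" using xsc by (intro eq_vecI) (auto simp: x0)
      then have "l2norm (x 0 - xs) = l2norm xs" by (simp add: l2norm_smult)
      also have "\<dots> \<le> sqrt lam_max" using lam_max by (simp add: real_le_rsqrt)
      also have "\<dots> \<le> sqrt (lam_max * real s)" using lm s1 by simp
      also have "\<dots> \<le> C * sqrt (lam_max * real s)"
        using mult_right_mono[of 1 C "sqrt (lam_max * real s)"] C8 lm by simp
      finally show ?case using s1 G by (simp add: x0 D algebra_simps)
    next
      case (Suc k)
      then have kK: "k < K" "k \<le> K" by auto
      have lam_k: "sqrt (lam k * real s) = sqrt (lam_max * real s) * sqrt \<gamma> ^ k"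
        by (simp add: it(1)[OF kK(2)] real_sqrt_mult real_sqrt_power)
      have R: "l2norm (x k - xs) \<le> C * sqrt (lam k * real s)"
        and sp: "real (grad_l0 E (x k)) + real s \<le> D * real s"
        using Suc.IH kK by (auto simp: lam_k)
      note st = iteration_step[OF \<kappa> t C D c G B xc[OF kK(2)] xc[OF Suc.prems] xsc _ _ it(3)[OF kK(1)]
          iso' obj[OF kK(1)] R sp]
      have "l2norm (x (Suc k) - xs) \<le> (1 - t / 4) * (C * sqrt (lam k * real s))"
        by (rule st(1)) (use s in auto)
      \<comment> \<open>The error contracts faster than the square root of \<open>lam k\<close>
        decays, so the bound survives the decrease of the penalty.\<close>
      also have "\<dots> \<le> sqrt \<gamma> * (C * sqrt (lam k * real s))"
        using real_less_rsqrt[OF \<gamma>] C8 it(3)[OF kK(1)] by (intro mult_right_mono) auto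
      finally have "l2norm (x (Suc k) - xs) \<le> C * sqrt (lam_max * real s) * sqrt \<gamma> ^ Suc k"
        unfolding lam_k by (simp add: mult_ac)
      moreover have "real (grad_l0 E (x (Suc k))) + real s \<le> D * real s"
        by (rule st(2)) (use s in auto)
      ultimately show ?case ..
    qed
    then show ?thesis ..
  qed
qed

theorem theorem3p4:
  fixes \<kappa> t :: real
  assumes kappa: "0 \<le> \<kappa>" "\<kappa> < sqrt (3/2) - 1"
    and t_def: "t = 1 - 4 * \<kappa> - 2 * \<kappa>\<^sup>2"
  shows "\<exists>C c. C > 0 \<and> c > 0 \<and>
    (\<forall>(p::nat) (E :: nat set set) (n::nat) (A :: real mat) (y :: real vec) (x\<^sub>s :: real vec) (e :: real vec)
      (\<rho> :: real \<Rightarrow> real) (\<eta>::real) (\<delta>::real) (\<gamma>::real) (lam_max::real) (s\<^sub>s::nat).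
       p \<ge> 3 \<and> simple_graph p E \<and> connected_graph p E \<and>
       A \<in> carrier_mat n p \<and> e = 0\<^sub>v n \<and> y = A *\<^sub>v x\<^sub>s + e \<and>
       \<eta> > 0 \<and> \<delta> > 0 \<and> x\<^sub>s \<in> grid_vec p \<delta> \<and> s\<^sub>s = max (grad_l0 E x\<^sub>s) 1 \<and>
       crip_function \<rho> \<and> cRIP p E \<kappa> \<rho> (sqrt \<eta> \<cdot>\<^sub>m A) \<and>
       isometry_bounds (sqrt \<eta> \<cdot>\<^sub>m A) \<kappa> (\<rho> (real s\<^sub>s)) x\<^sub>s
         \<comment> \<open>implied by cRIP unless \<open>x\<^sub>s\<close> is constant\<close> \<and>
       (1 - t / 4)\<^sup>2 < \<gamma> \<and> \<gamma> < 1 \<and> lam_max > (l2norm x\<^sub>s)\<^sup>2 \<and>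
       \<rho> (real s\<^sub>s) \<le> c \<longrightarrow>
       (\<exists>k\<^sub>0. \<forall>lam_min K lam a x.
          0 < lam_min \<and> lam_min < lam_max \<and>
          ITALE_run p E A y \<gamma> lam_max lam_min \<eta> \<delta> K lam a x \<and>
          (\<forall>k<K. \<not> labels_suffice p E (a (Suc k)) (lam k) \<delta> \<longrightarrow>
             alpha_guarantee p E (a (Suc k)) (lam k) \<delta> (x (Suc k))) \<longrightarrow>
          (\<forall>k\<le>K. l2norm (x k - x\<^sub>s) \<le> C * sqrt (lam_max * real s\<^sub>s) * \<gamma> powr (real k / 2)) \<and>
          (\<forall>k\<le>K. k\<^sub>0 \<le> k \<longrightarrow> x k = x\<^sub>s)))"
proof -
  \<comment> \<open>Completing the square, t = 3 - 2 (\<kappa> + 1)^2.\<close>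
  have "(\<kappa> + 1)\<^sup>2 < (sqrt (3/2))\<^sup>2" using kappa by (intro power_strict_mono) auto
  then have t0: "t > 0" by (simp add: t_def power2_eq_square algebra_simps)
  then have k4: "\<kappa> \<le> 1/4" using t_def zero_le_power2[of \<kappa>] by linarith
  \<comment> \<open>\<open>C\<close> solves (1 - t/2) C + 2 = (1 - t/4) C, the recursion for the
    error in units of sqrt (\<lambda> s). \<open>D\<close> solves q - 1 = 49 C^2 + 2 + q/2, the
    sparsity estimate. \<open>c\<close> makes the linear bound on \<rho> at sparsity 2 D s equal to
    (t/14)^2.\<close>
  define C D c where "C = 8 / t" and "D = 6 + 98 * C\<^sup>2" and "c = (t / 14)\<^sup>2 / (2 * D)"
  note bound = ITALE_error_bound[OF kappa(1) k4 t_def t0 C_def D_def c_def]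
  have "D > 0" unfolding D_def by (rule add_pos_nonneg) auto
  then have Cc: "C > 0" "c > 0" using t0 by (simp_all add: C_def c_def)
  show ?thesis
  proof (rule exI[of _ C], rule exI[of _ c], intro conjI allI impI, goal_cases)
    case 1 show ?case by (rule Cc)
  next
    case 2 show ?case by (rule Cc)
  next
    case (3 p E n A y x\<^sub>s e \<rho> \<eta> \<delta> \<gamma> lam_max s\<^sub>s)
    then have h: "simple_graph p E" "connected_graph p E" "A \<in> carrier_mat n p" "e = 0\<^sub>v n"
      "y = A *\<^sub>v x\<^sub>s + e" "\<eta> > 0" "\<delta> > 0" "x\<^sub>s \<in> grid_vec p \<delta>" "s\<^sub>s = max (grad_l0 E x\<^sub>s) 1"
      "crip_function \<rho>" "cRIP p E \<kappa> \<rho> (sqrt \<eta> \<cdot>\<^sub>m A)"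
      "isometry_bounds (sqrt \<eta> \<cdot>\<^sub>m A) \<kappa> (\<rho> (real s\<^sub>s)) x\<^sub>s"
      "(1 - t / 4)\<^sup>2 < \<gamma>" "\<gamma> < 1" "lam_max > (l2norm x\<^sub>s)\<^sup>2" "\<rho> (real s\<^sub>s) \<le> c"
      by blast+
    have y: "y = A *\<^sub>v x\<^sub>s" using h(3-5,8) by (simp add: grid_vec_def)
    have \<gamma>: "\<gamma> > 0" using h(13) zero_le_power2[of "1 - t / 4"] by linarith
    define M where "M = C * sqrt (lam_max * real s\<^sub>s)"
    \<comment> \<open>The threshold depends only on \<open>M\<close>, \<gamma> and \<delta>, so it
      is fixed before \<open>lam_min\<close> and the run.\<close>
    have "(\<lambda>k. M * sqrt \<gamma> ^ k) \<longlonglongrightarrow> M * 0"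
      using \<gamma> h(14) by (intro tendsto_mult_left LIMSEQ_power_zero) simp
    then have "\<forall>\<^sub>F k in sequentially. M * sqrt \<gamma> ^ k < \<delta>"
      using h(7) by (intro order_tendstoD) auto
    then obtain k\<^sub>0 where k0: "\<And>k. k \<ge> k\<^sub>0 \<Longrightarrow> M * sqrt \<gamma> ^ k < \<delta>"
      by (auto simp: eventually_sequentially)
    have powr: "sqrt \<gamma> ^ k = \<gamma> powr (real k / 2)" for k
      using \<gamma> by (simp add: powr_half_sqrt[symmetric] powr_power)
    show ?case
    proof (intro exI[of _ k\<^sub>0] allI impI, goal_cases)
      case (1 lam_min K lam a x)
      then have run: "lam_min > 0" "ITALE_run p E A (A *\<^sub>v x\<^sub>s) \<gamma> lam_max lam_min \<eta> \<delta> K lam a x"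
        and guar: "\<forall>k<K. \<not> labels_suffice p E (a (Suc k)) (lam k) \<delta> \<longrightarrow>
             alpha_guarantee p E (a (Suc k)) (lam k) \<delta> (x (Suc k))"
        unfolding y by blast+
      have b: "l2norm (x k - x\<^sub>s) \<le> M * sqrt \<gamma> ^ k" if "k \<le> K" for k
        unfolding M_def
        by (rule bound[OF h(1-3,6,8-10,16,11-13,15) run guar that])
      have "A *\<^sub>v x\<^sub>s \<in> carrier_vec n" using h(3,8) by (simp add: grid_vec_def)
      note grid = ITALE_run_iterates(2)[OF run(2,1) h(1,3) this guar]
      have "x k = x\<^sub>s" if "k \<le> K" "k\<^sub>0 \<le> k" for k
        using grid[OF that(1)] h(8) b[OF that(1)] k0[OF that(2)] by (intro grid_vec_eqI) auto
      with b show ?case by (auto simp: powr M_def)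
    qed
  qed
qed

end
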